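(* Let $R=V_r$ be an admissible causal inverse on $X=C[0,T]$ and $A=R^{-1}$ with domain $\mathcal D(A)=R(X)$. Let $B_1,\dots,B_N$ be linear operators on $\mathcal D(A)$ with $B_jR=V_{q_j}$, where $q_j\in L^1(0,T)$ and $|q_j(t)|\le C_jt^{\eta_j-1}$ a.e. on $(0,T)$ for some $C_j>0$, $\eta_j>0$. Let $p_1,\dots,p_N\in C[0,T]$ and $K\in C(\Delta_T)$. Let $\mathcal B\subset X$ be a finite-dimensional subspace with $\mathcal B\cap R(X)=\{0\}$, and let $\Lambda_j:\mathcal B\to X$ ($1\le j\le N$) be linear. On $\mathcal D(A_\partial)=\mathcal B\oplus R(X)$ define $$A_\partial(P+Rv)=v,\qquad B_{j,\partial}(P+Rv)=\Lambda_jP+V_{q_j}v\qquad(P\in\mathcal B,\ v\in X),$$ $$L_\partial u=A_\partial u+\sum_{j=1}^{N}p_j(t)B_{j,\partial}u+V_Ku ,$$ and for $P\in\mathcal B$ put $$F_\partial(P)(t)=\sum_{j=1}^{N}p_j(t)(\Lambda_jP)(t)+\int_0^tK(t,s)P(s)\,ds .$$ Let $G_L(t,s)=\sum_{j=1}^{N}p_j(t)q_j(t-s)+\int_s^tK(t,\xi)r(\xi-s)\,d\xi$, let $W_L=V_{G_L}$, and let $R_L$ be the resolvent kernel generated by $G_L$. Fix $P\in\mathcal B$. Then for every $f\in X$ the equation $L_\partial u=f$ has a unique solution in the affine slice $P+R(X)$, namely $$u=P+R(I-V_{R_L})\bigl(f-F_\partial(P)\bigr).$$ Equivalently, writing $u=P+Rv$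 gives the block factorization $L_\partial(P+Rv)=F_\partial(P)+(I+W_L)v$.
   Context: Fix $T>0$; functions are complex-valued; $\Delta_T=\{(t,s):0\le s\le t\le T\}$. For a univariate kernel $r\in L^1(0,T)$, $(V_rf)(t)=\int_0^tr(t-s)f(s)\,ds$; for a bivariate kernel $G$, $(V_Gf)(t)=\int_0^tG(t,s)f(s)\,ds$. An admissible causal inverse is an injective convolution operator $R=V_r:C[0,T]\to C[0,T]$, $r\in L^1(0,T)$, such that $|r(t)|\le C_0t^{\eta_0-1}$ for a.e. $0<t\le T$, for some $C_0>0$, $\eta_0>0$. Resolvent kernel: for a measurable kernel $G$ on $\{0\le s<t\le T\}$ with $V_G:C[0,T]\to C[0,T]$ and $|G(t,s)|\le C(t-s)^{\eta-1}$ a.e. for some $C,\eta>0$, put $G_1=G$, $G_{n+1}(t,s)=\int_s^tG(t,\xi)G_n(\xi,s)\,d\xi$; the resolvent kernel generated by $G$ is $R_G(t,s)=\sum_{n\ge1}(-1)^{n-1}G_n(t,s)$ (the series converges absolutely for a.e. $(t,s)$, and the induced operator series converges in operator norm on $C[0,T]$ to $V_{R_G}$). *)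

theory Defs
  imports "HOL-Analysis.Analysis" "HOL-Library.Function_Algebras"
begin

definition cfun_scale :: "complex \<Rightarrow> (real \<Rightarrow> complex) \<Rightarrow> real \<Rightarrow> complex" where
  "cfun_scale c f = (\<lambda>t. c * f t)"

interpretation cfun: vector_space cfun_scale
  by unfold_locales (auto simp: cfun_scale_def fun_eq_iff algebra_simps)

definition clinear_on ::
  "(real \<Rightarrow> complex) set \<Rightarrow> ((real \<Rightarrow> complex) \<Rightarrow> real \<Rightarrow> complex) \<Rightarrow> bool" where
  "clinear_on S F \<longleftrightarrow>
     (\<forall>x\<in>S. \<forall>y\<in>S. F (x + y) = F x + F y) \<and>
     (\<forall>c. \<forall>x\<in>S. F (cfun_scale c x) = cfun_scale c (F x))"

definition finite_dim_subspace :: "(real \<Rightarrow> complex) set \<Rightarrow> bool" where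
  "finite_dim_subspace S \<longleftrightarrow> cfun.subspace S \<and> (\<exists>E. finite E \<and> S = cfun.span E)"

text \<open>
  A function on the interval from 0 to T is represented by its extension by 0 to the real line,
  so that equality in C[0,T] is equality of functions.
\<close>

definition C0T :: "real \<Rightarrow> (real \<Rightarrow> complex) set" where
  "C0T T = {f. continuous_on {0..T} f \<and> (\<forall>t. t \<notin> {0..T} \<longrightarrow> f t = 0)}"

definition volterra ::
  "real \<Rightarrow> (real \<Rightarrow> real \<Rightarrow> complex) \<Rightarrow> (real \<Rightarrow> complex) \<Rightarrow> real \<Rightarrow> complex" where
  "volterra T G f = (\<lambda>t. if t \<in> {0..T} then LINT s:{0..t}|lebesgue. G t s * f s else 0)"

definition conv_op ::
  "real \<Rightarrow> (real \<Rightarrow> complex) \<Rightarrow> (real \<Rightarrow> complex) \<Rightarrow> real \<Rightarrow> complex" where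
  "conv_op T r = volterra T (\<lambda>t s. r (t - s))"

text \<open>Membership in \<open>L\<^sup>1(0,T)\<close> together with a weakly singular power bound almost everywhere.\<close>

definition weakly_singular :: "real \<Rightarrow> (real \<Rightarrow> complex) \<Rightarrow> bool" where
  "weakly_singular T r \<longleftrightarrow>
     set_integrable lebesgue {0<..<T} r \<and>
     (\<exists>C>0. \<exists>\<eta>>0. AE t in lebesgue. t \<in> {0<..<T} \<longrightarrow> norm (r t) \<le> C * t powr (\<eta> - 1))"

definition admissible_causal_inverse :: "real \<Rightarrow> (real \<Rightarrow> complex) \<Rightarrow> bool" where
  "admissible_causal_inverse T r \<longleftrightarrow>
     weakly_singular T r \<and>
     conv_op T r ` C0T T \<subseteq> C0T T \<and>
     inj_on (conv_op T r) (C0T T)"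

text \<open>The kernel \<open>iterated_kernel G n\<close> is the \<open>(n+1)\<close>-st iterate, starting from \<open>G\<close> itself at \<open>n = 0\<close>.\<close>

primrec iterated_kernel ::
  "(real \<Rightarrow> real \<Rightarrow> complex) \<Rightarrow> nat \<Rightarrow> real \<Rightarrow> real \<Rightarrow> complex" where
  "iterated_kernel G 0 = G"
| "iterated_kernel G (Suc n) =
     (\<lambda>t s. LINT \<xi>:{s..t}|lebesgue. G t \<xi> * iterated_kernel G n \<xi> s)"

definition resolvent_kernel ::
  "(real \<Rightarrow> real \<Rightarrow> complex) \<Rightarrow> real \<Rightarrow> real \<Rightarrow> complex" where
  "resolvent_kernel G t s = (\<Sum>n. (-1) ^ n * iterated_kernel G n t s)"

text \<open>
  For a subspace \<open>S\<close> of C[0,T] meeting the range of \<open>R = conv_op T r\<close> only in 0, with \<open>R\<close>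
  injective, these are the components \<open>P\<close> and \<open>v\<close> of an element \<open>u = P + R v\<close> of the direct
  sum of \<open>S\<close> and that range; they carry no meaning for other \<open>u\<close>.
\<close>

definition boundary_part ::
  "real \<Rightarrow> (real \<Rightarrow> complex) \<Rightarrow> (real \<Rightarrow> complex) set \<Rightarrow> (real \<Rightarrow> complex) \<Rightarrow> real \<Rightarrow> complex" where
  "boundary_part T r S u = (THE P. P \<in> S \<and> (\<exists>v\<in>C0T T. u = P + conv_op T r v))"

definition A_bd ::
  "real \<Rightarrow> (real \<Rightarrow> complex) \<Rightarrow> (real \<Rightarrow> complex) set \<Rightarrow> (real \<Rightarrow> complex) \<Rightarrow> real \<Rightarrow> complex" where
  "A_bd T r S u = (THE v. v \<in> C0T T \<and> (\<exists>P\<in>S. u = P + conv_op T r v))"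

definition B_bd ::
  "real \<Rightarrow> (real \<Rightarrow> complex) \<Rightarrow> (real \<Rightarrow> complex) set \<Rightarrow>
   ((real \<Rightarrow> complex) \<Rightarrow> real \<Rightarrow> complex) \<Rightarrow> (real \<Rightarrow> complex) \<Rightarrow>
   (real \<Rightarrow> complex) \<Rightarrow> real \<Rightarrow> complex" where
  "B_bd T r S \<Lambda> q u = \<Lambda> (boundary_part T r S u) + conv_op T q (A_bd T r S u)"

definition L_bd ::
  "real \<Rightarrow> (real \<Rightarrow> complex) \<Rightarrow> (real \<Rightarrow> complex) set \<Rightarrow> nat \<Rightarrow>
   (nat \<Rightarrow> (real \<Rightarrow> complex) \<Rightarrow> real \<Rightarrow> complex) \<Rightarrow> (nat \<Rightarrow> real \<Rightarrow> complex) \<Rightarrow>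
   (nat \<Rightarrow> real \<Rightarrow> complex) \<Rightarrow> (real \<Rightarrow> real \<Rightarrow> complex) \<Rightarrow>
   (real \<Rightarrow> complex) \<Rightarrow> real \<Rightarrow> complex" where
  "L_bd T r S N \<Lambda> q p K u =
     (\<lambda>t. A_bd T r S u t + (\<Sum>j=1..N. p j t * B_bd T r S (\<Lambda> j) (q j) u t) + volterra T K u t)"

definition F_bd ::
  "real \<Rightarrow> nat \<Rightarrow> (nat \<Rightarrow> (real \<Rightarrow> complex) \<Rightarrow> real \<Rightarrow> complex) \<Rightarrow>
   (nat \<Rightarrow> real \<Rightarrow> complex) \<Rightarrow> (real \<Rightarrow> real \<Rightarrow> complex) \<Rightarrow>
   (real \<Rightarrow> complex) \<Rightarrow> real \<Rightarrow> complex" where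
  "F_bd T N \<Lambda> p K P = (\<lambda>t. (\<Sum>j=1..N. p j t * \<Lambda> j P t) + volterra T K P t)"

definition G_L ::
  "(real \<Rightarrow> complex) \<Rightarrow> nat \<Rightarrow> (nat \<Rightarrow> real \<Rightarrow> complex) \<Rightarrow> (nat \<Rightarrow> real \<Rightarrow> complex) \<Rightarrow>
   (real \<Rightarrow> real \<Rightarrow> complex) \<Rightarrow> real \<Rightarrow> real \<Rightarrow> complex" where
  "G_L r N q p K t s =
     (\<Sum>j=1..N. p j t * q j (t - s)) + (LINT \<xi>:{s..t}|lebesgue. K t \<xi> * r (\<xi> - s))"

definition slice ::
  "real \<Rightarrow> (real \<Rightarrow> complex) \<Rightarrow> (real \<Rightarrow> complex) \<Rightarrow> (real \<Rightarrow> complex) set" where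
  "slice T r P = {P + conv_op T r v | v. v \<in> C0T T}"

end

theory Submission
  imports Defs
begin

text \<open>
  Since \<open>S\<close> meets the range of the convolution operator \<open>R\<close> only in 0 and \<open>R\<close> is injective, an
  element \<open>u = P + R v\<close> determines \<open>P\<close> and \<open>v\<close>. Substituting the components gives
  \<open>L u = F P + v + \<Sum>\<^sub>j p\<^sub>j (q\<^sub>j * v) + V\<^sub>K (R v)\<close>, and Fubini turns the last two terms into one Volterra
  operator \<open>W v\<close> with kernel \<open>G_L\<close>. On the slice through \<open>P\<close> the equation \<open>L u = f\<close> is
  therefore the Volterra equation of the second kind \<open>v + W v = f - F P\<close>, and its Neumann series is
  the resolvent kernel.

  Convergence of the Neumann series rests on one bound. All kernels here satisfy
  \<open>\<bar>H t s\<bar> \<le> k (t - s)\<close> with an integrable \<open>k\<close> that vanishes on the negative half-line. In the sup norm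
  with weight \<open>exp (l t)\<close> the operator with kernel \<open>H\<close> then has norm at most \<open>\<integral> k x exp (-l x) dx\<close>, which
  tends to 0 as \<open>l\<close> grows. So for large \<open>l\<close> it is a contraction (\<open>ex_contractive_row_bound\<close>); this takes the place
  of the customary estimates of the iterated kernels by Beta integrals. The same weighted row integrals
  control the iterated kernels by Tonelli, so their series converges absolutely for every \<open>t\<close> and almost
  every \<open>s\<close> and may be integrated term by term (\<open>kernel_op_neumann_kernel_sums\<close>).
  Continuity survives because the series of functions converges uniformly
  (\<open>second_kind_equation_C0T\<close>).

  The measure-theoretic obstacle is that \<open>r\<close> and \<open>q\<^sub>j\<close> are only Lebesgue measurable, so that
  \<open>r (t - s)\<close> is in general not measurable for the product \<open>\<sigma>\<close>-algebra and Fubini does not apply to it.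
  Each of them is replaced by a Borel function that agrees with it almost everywhere. Because the kernels
  depend on \<open>t - s\<close>, the kernel so obtained agrees with the original one almost everywhere in \<open>s\<close> for every
  \<open>t\<close> and also almost everywhere in \<open>t\<close> for every \<open>s\<close> (\<open>ae_kernel_eq\<close>); this two-sided relation passes to
  composed and iterated kernels, to the resolvent kernel, and to the operators
  (\<open>resolvent_kernel_ae_eq_neumann_kernel\<close>, \<open>G_L_borel_representative\<close>).
\<close>

section \<open>Operators with Borel kernels on the line\<close>

text \<open>
  A Volterra kernel is extended by 0 outside the triangle \<open>0 \<le> s \<le> t \<le> T\<close>, so that its
  operator and all compositions become integrals over the whole line, with no limits of integration
  to carry through Fubini.
\<close>

definition kernel_op :: "(real \<Rightarrow> real \<Rightarrow> complex) \<Rightarrow> (real \<Rightarrow> complex) \<Rightarrow> real \<Rightarrow> complex" where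
  "kernel_op H f t = (\<integral>s. H t s * f s \<partial>lborel)"

definition kernel_comp ::
  "(real \<Rightarrow> real \<Rightarrow> complex) \<Rightarrow> (real \<Rightarrow> real \<Rightarrow> complex) \<Rightarrow> real \<Rightarrow> real \<Rightarrow> complex" where
  "kernel_comp H H' t s = (\<integral>\<xi>. H t \<xi> * H' \<xi> s \<partial>lborel)"

primrec kernel_pow :: "(real \<Rightarrow> real \<Rightarrow> complex) \<Rightarrow> nat \<Rightarrow> real \<Rightarrow> real \<Rightarrow> complex" where
  "kernel_pow H 0 = H"
| "kernel_pow H (Suc n) = kernel_comp H (kernel_pow H n)"

abbreviation borel_kernel :: "(real \<Rightarrow> real \<Rightarrow> complex) \<Rightarrow> bool" where
  "borel_kernel H \<equiv> case_prod H \<in> borel_measurable (borel \<Otimes>\<^sub>M borel)"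

lemma borel_kernel_comp:
  assumes [measurable]: "borel_kernel H" "borel_kernel H'"
  shows "borel_kernel (kernel_comp H H')"
  unfolding kernel_comp_def by measurable

lemma borel_kernel_pow:
  assumes "borel_kernel H"
  shows "borel_kernel (kernel_pow H n)"
  by (induction n) (use assms borel_kernel_comp in auto)

definition neumann_kernel :: "(real \<Rightarrow> real \<Rightarrow> complex) \<Rightarrow> real \<Rightarrow> real \<Rightarrow> complex" where
  "neumann_kernel H t s = (\<Sum>n. (-1) ^ n * kernel_pow H n t s)"

text \<open>
  Measurability needs no convergence: where the series diverges, \<open>suminf\<close> still takes a
  value that depends measurably on the parameters.
\<close>

lemma borel_kernel_neumann_kernel:
  assumes "borel_kernel H"
  shows "borel_kernel (neumann_kernel H)"
proof -
  note [measurable] = borel_kernel_pow[OF assms]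
  show ?thesis unfolding neumann_kernel_def by measurable
qed

section \<open>Row bounds in a weighted sup norm and the Neumann series\<close>

locale weight =
  fixes w :: "real \<Rightarrow> real"
  assumes w_pos: "0 < w t"
    and w_borel [measurable]: "w \<in> borel_measurable borel"
begin

text \<open>
  The Schur test for the norm \<open>sup \<bar>f t\<bar> / w t\<close>: a kernel with \<open>row_bound M\<close> defines an operator
  of norm at most \<open>M\<close>, and \<open>dominated c f\<close> says that the norm of \<open>f\<close> is at most \<open>c\<close>.
  Bounding the integrals of the modulus of the kernel, rather than the operator, is what
  also yields absolute convergence of the Neumann series of kernels.
\<close>

definition row_bound :: "real \<Rightarrow> (real \<Rightarrow> real \<Rightarrow> complex) \<Rightarrow> bool" where
  "row_bound M H \<longleftrightarrow> 0 \<le> M \<and> borel_kernel H \<and>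
     (\<forall>t. (\<integral>\<^sup>+s. ennreal (norm (H t s) * w s) \<partial>lborel) \<le> ennreal (M * w t))"

definition dominated :: "real \<Rightarrow> (real \<Rightarrow> complex) \<Rightarrow> bool" where
  "dominated c f \<longleftrightarrow> 0 \<le> c \<and> f \<in> borel_measurable borel \<and> (\<forall>t. norm (f t) \<le> c * w t)"

lemma w_nonneg [simp]: "0 \<le> w t"
  using w_pos[of t] by simp

lemma nn_integral_kernel_apply:
  assumes H: "row_bound M H" and f: "dominated c f"
  shows "(\<integral>\<^sup>+s. ennreal (norm (H t s * f s)) \<partial>lborel) \<le> ennreal (c * M * w t)"
proof -
  from H f have [measurable]: "borel_kernel H" "f \<in> borel_measurable borel"
    by (auto simp: row_bound_def dominated_def)
  have c: "0 \<le> c" and M: "0 \<le> M" using H f by (auto simp: row_bound_def dominated_def)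
  have "(\<integral>\<^sup>+s. ennreal (norm (H t s * f s)) \<partial>lborel)
      \<le> (\<integral>\<^sup>+s. ennreal c * ennreal (norm (H t s) * w s) \<partial>lborel)"
  proof (intro nn_integral_mono)
    fix s
    have "norm (H t s * f s) \<le> norm (H t s) * (c * w s)"
      using f by (auto simp: norm_mult dominated_def intro!: mult_left_mono)
    then show "ennreal (norm (H t s * f s)) \<le> ennreal c * ennreal (norm (H t s) * w s)"
      using c by (simp add: ennreal_mult[symmetric] mult_ac ennreal_leI)
  qed
  also have "\<dots> = ennreal c * (\<integral>\<^sup>+s. ennreal (norm (H t s) * w s) \<partial>lborel)"
    by (intro nn_integral_cmult) measurable
  also have "\<dots> \<le> ennreal c * ennreal (M * w t)"
    using H by (intro mult_left_mono) (auto simp: row_bound_def)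
  also have "\<dots> = ennreal (c * M * w t)"
    using c M by (simp add: ennreal_mult[symmetric] mult_ac)
  finally show ?thesis .
qed

lemma integrable_kernel_apply:
  assumes H: "row_bound M H" and f: "dominated c f"
  shows "integrable lborel (\<lambda>s. H t s * f s)"
proof (rule integrableI_bounded)
  from H f have [measurable]: "borel_kernel H" "f \<in> borel_measurable borel"
    by (auto simp: row_bound_def dominated_def)
  show "(\<lambda>s. H t s * f s) \<in> borel_measurable lborel" by measurable
  show "(\<integral>\<^sup>+s. ennreal (norm (H t s * f s)) \<partial>lborel) < \<infinity>"
    using nn_integral_kernel_apply[OF assms, of t] by (rule le_less_trans) simp
qed

lemma dominated_kernel_op:
  assumes H: "row_bound M H" and f: "dominated c f"
  shows "dominated (c * M) (kernel_op H f)"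
proof -
  from H f have [measurable]: "borel_kernel H" "f \<in> borel_measurable borel"
    by (auto simp: row_bound_def dominated_def)
  have c: "0 \<le> c" and M: "0 \<le> M" using H f by (auto simp: row_bound_def dominated_def)
  have "kernel_op H f \<in> borel_measurable borel"
    unfolding kernel_op_def by measurable
  moreover have "norm (kernel_op H f t) \<le> c * M * w t" for t
  proof -
    have "ennreal (norm (kernel_op H f t)) \<le> (\<integral>\<^sup>+s. ennreal (norm (H t s * f s)) \<partial>lborel)"
      unfolding kernel_op_def by (rule integral_norm_bound_ennreal[OF integrable_kernel_apply[OF assms]])
    also note nn_integral_kernel_apply[OF assms, of t]
    finally show ?thesis using c M by (simp add: ennreal_le_iff)
  qed
  ultimately show ?thesis using c M by (simp add: dominated_def)
qed

text \<open>
  Tonelli makes row bounds multiplicative. The estimate is made on the double integral because it serves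
  twice: for the bound on the composed kernel, and for the integrability that Fubini requires.
\<close>

lemma nn_integral_two_kernels:
  assumes H: "row_bound M H" and H': "row_bound M' H'"
  shows "(\<integral>\<^sup>+s. (\<integral>\<^sup>+\<xi>. ennreal (norm (H t \<xi> * H' \<xi> s) * w s) \<partial>lborel) \<partial>lborel) \<le> ennreal (M * M' * w t)"
proof -
  from H H' have [measurable]: "borel_kernel H" "borel_kernel H'"
    by (auto simp: row_bound_def)
  have M: "0 \<le> M" "0 \<le> M'" using H H' by (auto simp: row_bound_def)
  have "(\<integral>\<^sup>+s. (\<integral>\<^sup>+\<xi>. ennreal (norm (H t \<xi> * H' \<xi> s) * w s) \<partial>lborel) \<partial>lborel)
      = (\<integral>\<^sup>+\<xi>. (\<integral>\<^sup>+s. ennreal (norm (H t \<xi> * H' \<xi> s) * w s) \<partial>lborel) \<partial>lborel)"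
    by (intro lborel_pair.Fubini') measurable
  also have "\<dots> = (\<integral>\<^sup>+\<xi>. ennreal (norm (H t \<xi>)) * (\<integral>\<^sup>+s. ennreal (norm (H' \<xi> s) * w s) \<partial>lborel) \<partial>lborel)"
    by (subst nn_integral_cmult[symmetric])
       (auto simp: norm_mult ennreal_mult[symmetric] mult_ac)
  also have "\<dots> \<le> (\<integral>\<^sup>+\<xi>. ennreal (norm (H t \<xi>)) * ennreal (M' * w \<xi>) \<partial>lborel)"
    using H' by (intro nn_integral_mono mult_left_mono) (auto simp: row_bound_def)
  also have "\<dots> = (\<integral>\<^sup>+\<xi>. ennreal M' * ennreal (norm (H t \<xi>) * w \<xi>) \<partial>lborel)"
    using M by (intro nn_integral_cong) (simp add: ennreal_mult[symmetric] mult_ac)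
  also have "\<dots> = ennreal M' * (\<integral>\<^sup>+\<xi>. ennreal (norm (H t \<xi>) * w \<xi>) \<partial>lborel)"
    by (intro nn_integral_cmult) measurable
  also have "\<dots> \<le> ennreal M' * ennreal (M * w t)"
    using H by (intro mult_left_mono) (auto simp: row_bound_def)
  also have "\<dots> = ennreal (M * M' * w t)"
    using M by (simp add: ennreal_mult[symmetric] mult_ac)
  finally show ?thesis .
qed

lemma row_bound_kernel_comp:
  assumes H: "row_bound M H" and H': "row_bound M' H'"
  shows "row_bound (M * M') (kernel_comp H H')"
proof -
  from H H' have [measurable]: "borel_kernel H" "borel_kernel H'"
    by (auto simp: row_bound_def)
  have M: "0 \<le> M" "0 \<le> M'" using H H' by (auto simp: row_bound_def)
  have "(\<integral>\<^sup>+s. ennreal (norm (kernel_comp H H' t s) * w s) \<partial>lborel) \<le> ennreal (M * M' * w t)" for t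
  proof -
    have *: "ennreal (norm (kernel_comp H H' t s) * w s)
        \<le> (\<integral>\<^sup>+\<xi>. ennreal (norm (H t \<xi> * H' \<xi> s) * w s) \<partial>lborel)" for s
    proof -
      have "ennreal (norm (kernel_comp H H' t s)) \<le> (\<integral>\<^sup>+\<xi>. ennreal (norm (H t \<xi> * H' \<xi> s)) \<partial>lborel)"
      \<comment> \<open>A divergent inner integral has the value 0 by convention, which respects the bound.\<close>
      proof (cases "integrable lborel (\<lambda>\<xi>. H t \<xi> * H' \<xi> s)")
        case True
        then show ?thesis unfolding kernel_comp_def by (rule integral_norm_bound_ennreal)
      next
        case False
        then show ?thesis unfolding kernel_comp_def by (simp add: not_integrable_integral_eq)
      qed
      then have "ennreal (w s) * ennreal (norm (kernel_comp H H' t s))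
          \<le> ennreal (w s) * (\<integral>\<^sup>+\<xi>. ennreal (norm (H t \<xi> * H' \<xi> s)) \<partial>lborel)"
        by (rule mult_left_mono) simp
      also have "\<dots> = (\<integral>\<^sup>+\<xi>. ennreal (w s) * ennreal (norm (H t \<xi> * H' \<xi> s)) \<partial>lborel)"
        by (rule nn_integral_cmult[symmetric]) measurable
      finally show ?thesis by (simp add: ennreal_mult[symmetric] mult_ac)
    qed
    show ?thesis
      by (rule order_trans[OF nn_integral_mono[OF *] nn_integral_two_kernels[OF assms]])
  qed
  then show ?thesis
    using M borel_kernel_comp[of H H'] by (auto simp: row_bound_def)
qed

lemma kernel_op_kernel_comp:
  assumes H: "row_bound M H" and H': "row_bound M' H'" and f: "dominated c f"
  shows "kernel_op (kernel_comp H H') f t = kernel_op H (kernel_op H' f) t"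
proof -
  from H H' f have [measurable]: "borel_kernel H" "borel_kernel H'" "f \<in> borel_measurable borel"
    by (auto simp: row_bound_def dominated_def)
  have M: "0 \<le> M" "0 \<le> M'" "0 \<le> c" using H H' f by (auto simp: row_bound_def dominated_def)
  let ?h = "\<lambda>s \<xi>. H t \<xi> * H' \<xi> s * f s"
  have int: "integrable (lborel \<Otimes>\<^sub>M lborel) (case_prod ?h)"
  proof (rule integrableI_bounded)
    show "case_prod ?h \<in> borel_measurable (lborel \<Otimes>\<^sub>M lborel)" by measurable
    have "(\<integral>\<^sup>+z. ennreal (norm (case_prod ?h z)) \<partial>(lborel \<Otimes>\<^sub>M lborel))
        = (\<integral>\<^sup>+s. (\<integral>\<^sup>+\<xi>. ennreal (norm (?h s \<xi>)) \<partial>lborel) \<partial>lborel)"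
      by (subst lborel.nn_integral_fst[symmetric]) auto
    also have "\<dots> \<le> (\<integral>\<^sup>+s. (\<integral>\<^sup>+\<xi>. ennreal c * ennreal (norm (H t \<xi> * H' \<xi> s) * w s) \<partial>lborel) \<partial>lborel)"
    proof (intro nn_integral_mono)
      fix s \<xi>
      have "norm (?h s \<xi>) \<le> norm (H t \<xi> * H' \<xi> s) * (c * w s)"
        unfolding norm_mult using f by (intro mult_left_mono) (auto simp: dominated_def)
      then show "ennreal (norm (?h s \<xi>)) \<le> ennreal c * ennreal (norm (H t \<xi> * H' \<xi> s) * w s)"
        using M by (simp add: ennreal_mult[symmetric] mult_ac ennreal_leI)
    qed
    also have "\<dots> = ennreal c * (\<integral>\<^sup>+s. (\<integral>\<^sup>+\<xi>. ennreal (norm (H t \<xi> * H' \<xi> s) * w s) \<partial>lborel) \<partial>lborel)"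
      by (simp add: nn_integral_cmult)
    also have "\<dots> \<le> ennreal c * ennreal (M * M' * w t)"
      by (intro mult_left_mono nn_integral_two_kernels assms) auto
    also have "\<dots> < \<infinity>" by (simp add: ennreal_mult_less_top)
    finally show "(\<integral>\<^sup>+z. ennreal (norm (case_prod ?h z)) \<partial>(lborel \<Otimes>\<^sub>M lborel)) < \<infinity>" .
  qed
  have "kernel_op (kernel_comp H H') f t = (\<integral>s. (\<integral>\<xi>. ?h s \<xi> \<partial>lborel) \<partial>lborel)"
    unfolding kernel_op_def kernel_comp_def by simp
  also have "\<dots> = (\<integral>\<xi>. (\<integral>s. ?h s \<xi> \<partial>lborel) \<partial>lborel)"
    by (rule lborel_pair.Fubini_integral[OF int, symmetric])
  also have "\<dots> = kernel_op H (kernel_op H' f) t"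
    unfolding kernel_op_def by (simp add: mult.assoc)
  finally show ?thesis .
qed

lemma row_bound_kernel_pow:
  assumes "row_bound \<rho> H"
  shows "row_bound (\<rho> ^ Suc n) (kernel_pow H n)"
proof (induction n)
  case (Suc n)
  then show ?case using row_bound_kernel_comp[OF assms Suc] by simp
qed (use assms in simp)

lemma kernel_op_kernel_pow:
  assumes "row_bound \<rho> H" and "dominated c f"
  shows "kernel_op (kernel_pow H n) f = (kernel_op H ^^ Suc n) f"
proof (induction n)
  case (Suc n)
  have "kernel_op (kernel_pow H (Suc n)) f = kernel_op H (kernel_op (kernel_pow H n) f)"
    using kernel_op_kernel_comp[OF assms(1) row_bound_kernel_pow[OF assms(1)] assms(2)] by (simp add: fun_eq_iff)
  with Suc show ?case by simp
qed (use assms in simp)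

lemma dominated_funpow:
  assumes "row_bound \<rho> H" and "dominated c f"
  shows "dominated (c * \<rho> ^ n) ((kernel_op H ^^ n) f)"
proof (induction n)
  case (Suc n)
  from dominated_kernel_op[OF assms(1) Suc] show ?case by (simp add: mult_ac)
qed (use assms in simp)

lemma kernel_op_diff:
  assumes "row_bound M H" and "dominated c f" and "dominated d g"
  shows "kernel_op H (\<lambda>s. f s - g s) t = kernel_op H f t - kernel_op H g t"
  unfolding kernel_op_def
  using integrable_kernel_apply[OF assms(1,2), of t] integrable_kernel_apply[OF assms(1,3), of t]
  by (simp add: algebra_simps)

lemma dominated_diff:
  assumes "dominated c f" and "dominated d g"
  shows "dominated (c + d) (\<lambda>s. f s - g s)"
  using assms unfolding dominated_def 
  by (auto simp: distrib_right intro: order_trans[OF norm_triangle_ineq4] add_mono)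

text \<open>
  The \<open>n\<close>-th term has row bound \<open>\<rho> ^ Suc n\<close>, so the row integrals of the moduli are summable;
  hence the series of kernels converges absolutely for almost every \<open>s\<close>, and integration
  against \<open>f\<close> commutes with the sum.
\<close>

lemma kernel_op_neumann_kernel_sums:
  assumes H: "row_bound \<rho> H" and \<rho>: "\<rho> < 1" and f: "dominated c f"
  shows "(\<lambda>n. (-1) ^ n * (kernel_op H ^^ Suc n) f t) sums kernel_op (neumann_kernel H) f t"
proof -
  have bK: "borel_kernel (kernel_pow H n)" for n
    using H by (intro borel_kernel_pow) (auto simp: row_bound_def)
  note [measurable] = bK
  have [measurable]: "f \<in> borel_measurable borel" using f by (simp add: dominated_def)
  have \<rho>0: "0 \<le> \<rho>" and c: "0 \<le> c" using H f by (auto simp: row_bound_def dominated_def)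
  let ?F = "\<lambda>n s. (-1) ^ n * kernel_pow H n t s * f s"
  have int: "integrable lborel (\<lambda>s. kernel_pow H n t s * f s)" for n
    by (rule integrable_kernel_apply[OF row_bound_kernel_pow[OF H] f])
  have AE_summable: "AE s in lborel. summable (\<lambda>n. norm (kernel_pow H n t s))"
  proof -
    have "(\<integral>\<^sup>+s. (\<Sum>n. ennreal (norm (kernel_pow H n t s) * w s)) \<partial>lborel)
        = (\<Sum>n. \<integral>\<^sup>+s. ennreal (norm (kernel_pow H n t s) * w s) \<partial>lborel)"
      by (intro nn_integral_suminf) measurable
    also have "\<dots> \<le> (\<Sum>n. ennreal (\<rho> ^ Suc n * w t))"
      using row_bound_kernel_pow[OF H] by (intro suminf_le) (auto simp: row_bound_def)
    also have "\<dots> = ennreal (\<Sum>n. \<rho> ^ Suc n * w t)"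
      using \<rho> \<rho>0 by (intro suminf_ennreal2) (auto intro!: summable_mult summable_mult2 summable_geometric)
    finally have "(\<integral>\<^sup>+s. (\<Sum>n. ennreal (norm (kernel_pow H n t s) * w s)) \<partial>lborel) \<noteq> \<infinity>"
      by (auto simp: top_unique)
    then have "AE s in lborel. (\<Sum>n. ennreal (norm (kernel_pow H n t s) * w s)) \<noteq> \<infinity>"
      by (intro nn_integral_PInf_AE) measurable
    then show ?thesis
    proof eventually_elim
      case (elim s)
      then have "summable (\<lambda>n. norm (kernel_pow H n t s) * w s)"
        by (intro summable_suminf_not_top) auto
      \<comment> \<open>Positivity of the weight removes it from the summability statement.\<close>
      from summable_mult2[OF this, of "inverse (w s)"] w_pos[of s] show ?case
        by (simp add: mult.assoc)
    qed
  qed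
  have norm_int: "(\<integral>s. norm (kernel_pow H n t s * f s) \<partial>lborel) \<le> c * \<rho> ^ Suc n * w t" for n
  proof -
    have "ennreal (\<integral>s. norm (kernel_pow H n t s * f s) \<partial>lborel) = (\<integral>\<^sup>+s. ennreal (norm (kernel_pow H n t s * f s)) \<partial>lborel)"
      by (intro nn_integral_eq_integral[symmetric] integrable_norm int) auto
    also have "\<dots> \<le> ennreal (c * \<rho> ^ Suc n * w t)"
      by (rule nn_integral_kernel_apply[OF row_bound_kernel_pow[OF H] f])
    finally show ?thesis using \<rho>0 c by (subst (asm) ennreal_le_iff) auto
  qed
  have "(\<lambda>n. \<integral>s. ?F n s \<partial>lborel) sums (\<integral>s. (\<Sum>n. ?F n s) \<partial>lborel)"
  proof (rule sums_integral)
    show "integrable lborel (?F n)" for n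
      using integrable_mult_right[OF int[of n], of "(-1) ^ n"] by (simp add: mult_ac)
    show "AE s in lborel. summable (\<lambda>n. norm (?F n s))"
      using AE_summable by eventually_elim (auto simp: norm_mult norm_power intro: summable_mult2)
    show "summable (\<lambda>n. \<integral>s. norm (?F n s) \<partial>lborel)"
    proof (rule summable_comparison_test')
      show "summable (\<lambda>n. c * \<rho> ^ Suc n * w t)"
        using \<rho> \<rho>0 by (auto intro!: summable_mult summable_mult2 summable_geometric)
      show "norm (\<integral>s. norm (?F n s) \<partial>lborel) \<le> c * \<rho> ^ Suc n * w t" if "n \<ge> 0" for n
        using norm_int[of n] by (simp add: norm_mult norm_power)
    qed
  qed
  moreover have "(\<integral>s. ?F n s \<partial>lborel) = (-1) ^ n * (kernel_op H ^^ Suc n) f t" for n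
  proof -
    have "(kernel_op H ^^ Suc n) f t = (\<integral>s. kernel_pow H n t s * f s \<partial>lborel)"
      by (simp only: kernel_op_kernel_pow[OF H f, symmetric] kernel_op_def)
    then show ?thesis by (simp only: mult.assoc integral_mult_right_zero)
  qed
  moreover have "(\<integral>s. (\<Sum>n. ?F n s) \<partial>lborel) = kernel_op (neumann_kernel H) f t"
  proof -
    have ae: "AE s in lborel. (\<Sum>n. ?F n s) = neumann_kernel H t s * f s"
      using AE_summable
    proof eventually_elim
      case (elim s)
      then have "summable (\<lambda>n. norm ((-1) ^ n * kernel_pow H n t s))"
        by (simp add: norm_mult norm_power)
      then have "summable (\<lambda>n. (-1) ^ n * kernel_pow H n t s)"
        by (rule summable_norm_cancel)
      from suminf_mult2[OF this, of "f s"] show ?case by (simp add: neumann_kernel_def)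
    qed
    have m: "(\<lambda>s. neumann_kernel H t s * f s) \<in> borel_measurable lborel"
      unfolding neumann_kernel_def by measurable
    have m': "(\<lambda>s. \<Sum>n. ?F n s) \<in> borel_measurable lborel"
      by measurable
    show ?thesis
      unfolding kernel_op_def by (rule integral_cong_AE[OF m' m ae])
  qed
  ultimately show ?thesis by simp
qed

text \<open>
  The remainder is a geometric tail in the weighted norm. It gives the size of the sum (for \<open>m = 0\<close>),
  the exchange of the operator with the series, and uniform convergence.
\<close>

lemma neumann_remainder_bound:
  assumes H: "row_bound \<rho> H" and \<rho>: "\<rho> < 1" and f: "dominated c f"
  shows "norm (kernel_op (neumann_kernel H) f t - (\<Sum>n<m. (-1) ^ n * (kernel_op H ^^ Suc n) f t))
    \<le> c / (1 - \<rho>) * \<rho> ^ m * w t"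
proof -
  have \<rho>0: "0 \<le> \<rho>" and c: "0 \<le> c" using H f by (auto simp: row_bound_def dominated_def)
  let ?a = "\<lambda>n. (-1) ^ n * (kernel_op H ^^ Suc n) f t"
  have b: "norm (?a n) \<le> c * w t * \<rho> ^ n" for n
  proof -
    have "norm (?a n) \<le> c * \<rho> ^ Suc n * w t"
      using dominated_funpow[OF H f, of "Suc n"] unfolding dominated_def norm_mult norm_power by simp
    also have "\<dots> \<le> c * \<rho> ^ n * w t"
      using \<rho> \<rho>0 c by (intro mult_right_mono mult_left_mono power_decreasing) auto
    finally show ?thesis by (simp add: mult_ac)
  qed
  have "(\<lambda>n. ?a (n + m)) sums (kernel_op (neumann_kernel H) f t - (\<Sum>n<m. ?a n))"
    using sums_split_initial_segment[OF kernel_op_neumann_kernel_sums[OF assms]] .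
  moreover have s: "(\<lambda>n. c * w t * \<rho> ^ (n + m)) sums (c / (1 - \<rho>) * \<rho> ^ m * w t)"
    using sums_mult[OF geometric_sums[of \<rho>], of "c * w t * \<rho> ^ m"] \<rho> \<rho>0
    by (simp add: power_add mult_ac)
  ultimately show ?thesis
    using norm_suminf_le[of "\<lambda>n. ?a (n + m)", OF b sums_summable[OF s]]
    by (simp only: sums_iff)
qed

lemma dominated_kernel_op_neumann_kernel:
  assumes H: "row_bound \<rho> H" and \<rho>: "\<rho> < 1" and f: "dominated c f"
  shows "dominated (c / (1 - \<rho>)) (kernel_op (neumann_kernel H) f)"
proof -
  from H f have [measurable]: "borel_kernel (neumann_kernel H)" "f \<in> borel_measurable borel"
    by (auto simp: row_bound_def dominated_def intro: borel_kernel_neumann_kernel)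
  have "kernel_op (neumann_kernel H) f \<in> borel_measurable borel"
    unfolding kernel_op_def by measurable
  then show ?thesis
    using neumann_remainder_bound[OF assms, of _ 0] f \<rho> by (simp add: dominated_def)
qed

text \<open>
  Applying the operator to a partial sum shifts it by one term; the
  remainder bound allows passing to the limit on both sides.
\<close>

lemma neumann_right_inverse:
  assumes H: "row_bound \<rho> H" and \<rho>: "\<rho> < 1" and f: "dominated c f"
  defines "x \<equiv> (\<lambda>t. f t - kernel_op (neumann_kernel H) f t)"
  shows "x t + kernel_op H x t = f t"
proof -
  have \<rho>0: "0 \<le> \<rho>" and c: "0 \<le> c" using H f by (auto simp: row_bound_def dominated_def)
  define y where "y = kernel_op (neumann_kernel H) f"
  define S where "S m t = (\<Sum>n<m. (-1) ^ n * (kernel_op H ^^ Suc n) f t)" for m t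
  have y: "dominated (c / (1 - \<rho>)) y"
    unfolding y_def by (rule dominated_kernel_op_neumann_kernel[OF H \<rho> f])
  have err: "dominated (c / (1 - \<rho>) * \<rho> ^ m) (\<lambda>t. y t - S m t)" for m
  proof -
    have "(kernel_op H ^^ Suc n) f \<in> borel_measurable borel" for n
      using dominated_funpow[OF H f, of "Suc n"] by (auto simp: dominated_def)
    note [measurable] = this
    have [measurable]: "y \<in> borel_measurable borel" using y by (simp add: dominated_def)
    have "(\<lambda>t. y t - S m t) \<in> borel_measurable borel"
      unfolding S_def by measurable
    then show ?thesis
      using neumann_remainder_bound[OF H \<rho> f, of _ m] c \<rho> \<rho>0 by (simp add: dominated_def y_def S_def)
  qed
  have S: "dominated (c / (1 - \<rho>) + c / (1 - \<rho>) * \<rho> ^ m) (S m)" for m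
    using dominated_diff[OF y err[of m]] by simp
  have kernel_op_S: "kernel_op H (S m) t = kernel_op H f t - S (Suc m) t" for m
  proof -
    have int: "integrable lborel (\<lambda>s. H t s * ((-1) ^ n * (kernel_op H ^^ Suc n) f s))" for n
      using integrable_mult_right[OF integrable_kernel_apply[OF H dominated_funpow[OF H f, of "Suc n"], of t],
          of "(-1) ^ n"] by (simp only: mult_ac)
    have "kernel_op H (S m) t = (\<integral>s. (\<Sum>n<m. H t s * ((-1) ^ n * (kernel_op H ^^ Suc n) f s)) \<partial>lborel)"
      unfolding kernel_op_def S_def sum_distrib_left ..
    also have "\<dots> = (\<Sum>n<m. \<integral>s. H t s * ((-1) ^ n * (kernel_op H ^^ Suc n) f s) \<partial>lborel)"
      by (intro Bochner_Integration.integral_sum int)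
    also have "\<dots> = (\<Sum>n<m. (-1) ^ n * (kernel_op H ^^ Suc (Suc n)) f t)"
    proof (intro sum.cong refl)
      fix n
      have "(\<integral>s. H t s * ((-1) ^ n * (kernel_op H ^^ Suc n) f s) \<partial>lborel)
          = (\<integral>s. (-1) ^ n * (H t s * (kernel_op H ^^ Suc n) f s) \<partial>lborel)"
        by (simp only: mult.left_commute)
      also have "\<dots> = (-1) ^ n * kernel_op H ((kernel_op H ^^ Suc n) f) t"
        unfolding kernel_op_def by (rule integral_mult_right_zero)
      finally show "(\<integral>s. H t s * ((-1) ^ n * (kernel_op H ^^ Suc n) f s) \<partial>lborel)
          = (-1) ^ n * (kernel_op H ^^ Suc (Suc n)) f t" by simp
    qed
    also have "\<dots> = kernel_op H f t - S (Suc m) t"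
      unfolding S_def by (subst sum.lessThan_Suc_shift) (simp add: sum_negf)
    finally show ?thesis .
  qed
  have "(\<lambda>m. S (Suc m) t) \<longlonglongrightarrow> y t"
    using kernel_op_neumann_kernel_sums[OF H \<rho> f, of t]
    unfolding S_def y_def sums_def by (rule LIMSEQ_Suc)
  then have "(\<lambda>m. kernel_op H (S m) t) \<longlonglongrightarrow> kernel_op H f t - y t"
    unfolding kernel_op_S by (intro tendsto_intros)
  moreover have "(\<lambda>m. kernel_op H (S m) t) \<longlonglongrightarrow> kernel_op H y t"
  proof (rule Lim_transform2[OF tendsto_const], rule Lim_null_comparison)
    show "\<forall>\<^sub>F m in sequentially. norm (kernel_op H y t - kernel_op H (S m) t) \<le> c / (1 - \<rho>) * \<rho> ^ m * \<rho> * w t"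
      using dominated_kernel_op[OF H err] by (auto simp: dominated_def kernel_op_diff[OF H y S])
    have "(\<lambda>m. c / (1 - \<rho>) * \<rho> ^ m * \<rho> * w t) \<longlonglongrightarrow> c / (1 - \<rho>) * 0 * \<rho> * w t"
      using \<rho> \<rho>0 by (intro tendsto_intros LIMSEQ_realpow_zero) auto
    then show "(\<lambda>m. c / (1 - \<rho>) * \<rho> ^ m * \<rho> * w t) \<longlonglongrightarrow> 0" by simp
  qed
  ultimately have "kernel_op H y t = kernel_op H f t - y t"
    using LIMSEQ_unique by blast
  then show ?thesis
    unfolding x_def using kernel_op_diff[OF H f y, of t] by (simp add: y_def)
qed

text \<open>
  The difference \<open>z\<close> of two solutions satisfies \<open>z = - H z\<close>, so its weighted norm shrinks by
  the factor \<open>\<rho>\<close> indefinitely.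
\<close>

lemma one_plus_kernel_op_injective:
  assumes H: "row_bound \<rho> H" and \<rho>: "\<rho> < 1"
    and f: "dominated c f" and g: "dominated d g"
    and eq: "\<And>t. f t + kernel_op H f t = g t + kernel_op H g t"
  shows "f = g"
proof
  fix t
  have \<rho>0: "0 \<le> \<rho>" using H by (auto simp: row_bound_def)
  define z where "z = (\<lambda>t. f t - g t)"
  have z: "kernel_op H z t = - z t" for t
    using eq[of t] unfolding z_def kernel_op_diff[OF H f g] by (simp add: algebra_simps add_eq_0_iff)
  have "dominated ((c + d) * \<rho> ^ n) z" for n
  proof (induction n)
    case 0
    show ?case using dominated_diff[OF f g] by (simp add: z_def)
  next
    case (Suc n)
    from dominated_kernel_op[OF H Suc] Suc show ?case
      by (simp add: dominated_def z mult_ac)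
  qed
  then have "\<forall>n\<ge>0. norm (z t) \<le> (c + d) * \<rho> ^ n * w t" by (simp add: dominated_def)
  moreover have "(\<lambda>n. (c + d) * \<rho> ^ n * w t) \<longlonglongrightarrow> (c + d) * 0 * w t"
    using \<rho> \<rho>0 by (intro tendsto_intros LIMSEQ_realpow_zero) auto
  ultimately have "norm (z t) \<le> (c + d) * 0 * w t"
    by (intro LIMSEQ_le_const) auto
  then show "f t = g t" by (simp add: z_def)
qed

lemma continuous_on_kernel_op_neumann_kernel:
  assumes H: "row_bound \<rho> H" and \<rho>: "\<rho> < 1" and f: "dominated c f"
    and bdd: "\<And>t. t \<in> A \<Longrightarrow> w t \<le> W"
    and cont: "\<And>n. continuous_on A ((kernel_op H ^^ Suc n) f)"
  shows "continuous_on A (kernel_op (neumann_kernel H) f)"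
proof (rule uniform_limit_theorem[where F = sequentially])
  have \<rho>0: "0 \<le> \<rho>" and c: "0 \<le> c" using H f by (auto simp: row_bound_def dominated_def)
  let ?S = "\<lambda>m t. \<Sum>n<m. (-1) ^ n * (kernel_op H ^^ Suc n) f t"
  show "\<forall>\<^sub>F m in sequentially. continuous_on A (?S m)"
    by (intro always_eventually allI continuous_intros cont)
  show "uniform_limit A ?S (kernel_op (neumann_kernel H) f) sequentially"
  proof (rule uniform_limitI)
    fix e :: real assume "e > 0"
    have "(\<lambda>m. c / (1 - \<rho>) * \<rho> ^ m * \<bar>W\<bar>) \<longlonglongrightarrow> c / (1 - \<rho>) * 0 * \<bar>W\<bar>"
      using \<rho> \<rho>0 by (intro tendsto_intros LIMSEQ_realpow_zero) auto
    then have "\<forall>\<^sub>F m in sequentially. c / (1 - \<rho>) * \<rho> ^ m * \<bar>W\<bar> < e"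
      using \<open>e > 0\<close> by (intro order_tendstoD) auto
    then show "\<forall>\<^sub>F m in sequentially. \<forall>t\<in>A. dist (?S m t) (kernel_op (neumann_kernel H) f t) < e"
    proof eventually_elim
      case (elim m)
      show ?case
      proof
        fix t assume "t \<in> A"
        have "dist (?S m t) (kernel_op (neumann_kernel H) f t) \<le> c / (1 - \<rho>) * \<rho> ^ m * w t"
          using neumann_remainder_bound[OF H \<rho> f, of t m] by (simp add: dist_norm norm_minus_commute)
        also have "\<dots> \<le> c / (1 - \<rho>) * \<rho> ^ m * \<bar>W\<bar>"
          using bdd[OF \<open>t \<in> A\<close>] c \<rho> \<rho>0 by (intro mult_left_mono) auto
        also note elim
        finally show "dist (?S m t) (kernel_op (neumann_kernel H) f t) < e" .
      qed
    qed
  qed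
qed simp

end

section \<open>Lebesgue measurable kernels on the triangle\<close>

definition on_triangle :: "real \<Rightarrow> (real \<Rightarrow> real \<Rightarrow> complex) \<Rightarrow> real \<Rightarrow> real \<Rightarrow> complex" where
  "on_triangle T G t s = (if 0 \<le> s \<and> s \<le> t \<and> t \<le> T then G t s else 0)"

text \<open>
  Almost everywhere equality on the plane would not do: the operators are evaluated at every \<open>t\<close>, and a
  composition evaluates its second factor along lines with fixed \<open>s\<close>. Hence equality is required almost
  everywhere on each horizontal and each vertical line.
\<close>

definition ae_kernel_eq ::
  "(real \<Rightarrow> real \<Rightarrow> complex) \<Rightarrow> (real \<Rightarrow> real \<Rightarrow> complex) \<Rightarrow> bool" where
  "ae_kernel_eq G H \<longleftrightarrow>
     (\<forall>t. AE s in lborel. G t s = H t s) \<and> (\<forall>s. AE t in lborel. G t s = H t s)"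

lemma volterra_on_triangle:
  "volterra T G f t = (\<integral>s. on_triangle T G t s * f s \<partial>lebesgue)"
proof -
  have "on_triangle T G t s * f s
      = (if t \<in> {0..T} then indicator {0..t} s *\<^sub>R (G t s * f s) else 0)" for s
    by (auto simp: on_triangle_def indicator_def)
  then show ?thesis
    by (auto simp: volterra_def set_lebesgue_integral_def)
qed

text \<open>
  The limits of integration \<open>s\<close> and \<open>t\<close> in the iteration are exactly what the
  supports of the two restricted factors impose.
\<close>

lemma iterated_kernel_Suc_on_triangle:
  "on_triangle T (iterated_kernel G (Suc n)) t s
     = (\<integral>\<xi>. on_triangle T G t \<xi> * on_triangle T (iterated_kernel G n) \<xi> s \<partial>lebesgue)"
proof -
  have "on_triangle T G t \<xi> * on_triangle T (iterated_kernel G n) \<xi> s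
      = (if 0 \<le> s \<and> s \<le> t \<and> t \<le> T
         then indicator {s..t} \<xi> *\<^sub>R (G t \<xi> * iterated_kernel G n \<xi> s) else 0)" for \<xi>
    by (auto simp: on_triangle_def indicator_def)
  then show ?thesis
    by (auto simp: on_triangle_def set_lebesgue_integral_def)
qed

text \<open>
  Lebesgue measure is complete, so \<open>g\<close> inherits measurability from \<open>h\<close>. This is what lets a Borel representative replace a kernel inside an integral.
\<close>

lemma integral_lebesgue_eq_lborel_AE:
  fixes g h :: "real \<Rightarrow> complex"
  assumes h: "h \<in> borel_measurable borel" and ae: "AE x in lborel. g x = h x"
  shows "(\<integral>x. g x \<partial>lebesgue) = (\<integral>x. h x \<partial>lborel)"
proof -
  have hl: "h \<in> borel_measurable lebesgue" using h by (intro measurable_completion) simp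
  have ae': "AE x in lebesgue. g x = h x" using ae by (rule AE_completion)
  have "g \<in> borel_measurable lebesgue"
    by (rule borel_measurable_AE[OF hl]) (use ae' in auto)
  then have "(\<integral>x. g x \<partial>lebesgue) = (\<integral>x. h x \<partial>lebesgue)"
    using hl ae' by (intro integral_cong_AE)
  also have "\<dots> = (\<integral>x. h x \<partial>lborel)"
    using h by (intro integral_completion) simp
  finally show ?thesis .
qed

lemma volterra_eq_kernel_op:
  assumes "borel_kernel H" and "ae_kernel_eq (on_triangle T G) H" and "f \<in> borel_measurable borel"
  shows "volterra T G f = kernel_op H f"
proof
  fix t
  note [measurable] = assms(1,3)
  have "AE s in lborel. on_triangle T G t s * f s = H t s * f s"
    using assms(2) unfolding ae_kernel_eq_def by (auto elim: AE_mp)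
  moreover have "(\<lambda>s. H t s * f s) \<in> borel_measurable borel" by measurable
  ultimately show "volterra T G f t = kernel_op H f t"
    unfolding volterra_on_triangle kernel_op_def by (intro integral_lebesgue_eq_lborel_AE)
qed

lemma lebesgue_composition_eq_kernel_comp:
  assumes "borel_kernel H" and "ae_kernel_eq G H" and "borel_kernel H'" and "ae_kernel_eq G' H'"
  shows "(\<integral>\<xi>. G t \<xi> * G' \<xi> s \<partial>lebesgue) = kernel_comp H H' t s"
proof -
  note [measurable] = assms(1,3)
  have "AE \<xi> in lborel. G t \<xi> = H t \<xi>" "AE \<xi> in lborel. G' \<xi> s = H' \<xi> s"
    using assms(2,4) by (auto simp: ae_kernel_eq_def)
  then have "AE \<xi> in lborel. G t \<xi> * G' \<xi> s = H t \<xi> * H' \<xi> s"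
    by eventually_elim simp
  moreover have "(\<lambda>\<xi>. H t \<xi> * H' \<xi> s) \<in> borel_measurable borel" by measurable
  ultimately show ?thesis
    unfolding kernel_comp_def by (intro integral_lebesgue_eq_lborel_AE)
qed

text \<open>
  From the second iterate on, equality holds at every point: the integrand changes only on a null set
  of \<open>\<xi>\<close>, in the first factor by equality along the line of fixed \<open>t\<close>, in the second by equality along the line
  of fixed \<open>s\<close>.
\<close>

lemma iterated_kernel_ae_eq_kernel_pow:
  assumes "borel_kernel H" and "ae_kernel_eq (on_triangle T G) H"
  shows "ae_kernel_eq (on_triangle T (iterated_kernel G n)) (kernel_pow H n)"
proof (induction n)
  case 0
  show ?case using assms(2) by simp
next
  case (Suc n)
  have "on_triangle T (iterated_kernel G (Suc n)) t s = kernel_pow H (Suc n) t s" for t s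
    unfolding iterated_kernel_Suc_on_triangle kernel_pow.simps
    by (rule lebesgue_composition_eq_kernel_comp[OF assms borel_kernel_pow[OF assms(1)] Suc])
  then show ?case by (simp add: ae_kernel_eq_def del: iterated_kernel.simps kernel_pow.simps)
qed

lemma resolvent_kernel_ae_eq_neumann_kernel:
  assumes "borel_kernel H" and "ae_kernel_eq (on_triangle T G) H"
  shows "ae_kernel_eq (on_triangle T (resolvent_kernel G)) (neumann_kernel H)"
proof -
  have eq: "on_triangle T (resolvent_kernel G) t s = neumann_kernel H t s"
    if "\<forall>n. on_triangle T (iterated_kernel G n) t s = kernel_pow H n t s" for t s
    unfolding neumann_kernel_def that[rule_format, symmetric]
    by (cases "0 \<le> s \<and> s \<le> t \<and> t \<le> T") (auto simp: on_triangle_def resolvent_kernel_def)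
  show ?thesis
    unfolding ae_kernel_eq_def
  proof safe
    fix t
    have "AE s in lborel. \<forall>n. on_triangle T (iterated_kernel G n) t s = kernel_pow H n t s"
      using iterated_kernel_ae_eq_kernel_pow[OF assms] by (simp add: AE_all_countable ae_kernel_eq_def)
    then show "AE s in lborel. on_triangle T (resolvent_kernel G) t s = neumann_kernel H t s"
      by eventually_elim (rule eq)
  next
    fix s
    have "AE t in lborel. \<forall>n. on_triangle T (iterated_kernel G n) t s = kernel_pow H n t s"
      using iterated_kernel_ae_eq_kernel_pow[OF assms] by (simp add: AE_all_countable ae_kernel_eq_def)
    then show "AE t in lborel. on_triangle T (resolvent_kernel G) t s = neumann_kernel H t s"
      by eventually_elim (rule eq)
  qed
qed

section \<open>Kernels dominated by an integrable convolution kernel\<close>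

lemma weight_exp: "weight (\<lambda>t. exp (l * t))"
  by unfold_locales auto

text \<open>
  The majorant depends on \<open>t - s\<close> only, so its weighted row integrals can be bounded uniformly in \<open>t\<close>.
  It yields both a contraction (for a steep exponential weight) and absolute integrability, and it is stable
  under the operations that build \<open>G_L\<close>.
\<close>

definition convolution_dominated :: "(real \<Rightarrow> real \<Rightarrow> complex) \<Rightarrow> bool" where
  "convolution_dominated H \<longleftrightarrow> borel_kernel H \<and>
     (\<exists>k. integrable lborel k \<and> (\<forall>x. 0 \<le> k x) \<and> (\<forall>x<0. k x = 0) \<and>
       (\<forall>t s. norm (H t s) \<le> k (t - s)))"

text \<open>
  Writing \<open>exp (l s) = exp (l t) exp (- l (t - s))\<close> and substituting \<open>x = t - s\<close> turns the weighted
  row integral into \<open>exp (l t)\<close> times the Laplace transform of \<open>k\<close>.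
\<close>

lemma row_bound_exp:
  assumes bk: "borel_kernel H" and k: "integrable lborel k" and k0: "\<And>x. 0 \<le> k x"
    and kneg: "\<And>x. x < 0 \<Longrightarrow> k x = 0"
    and bd: "\<And>t s. norm (H t s) \<le> k (t - s)" and l: "0 \<le> l"
  shows "weight.row_bound (\<lambda>t. exp (l * t)) (\<integral>x. k x * exp (- (l * x)) \<partial>lborel) H"
proof -
  interpret weight "\<lambda>t. exp (l * t)" by (rule weight_exp)
  let ?I = "\<integral>x. k x * exp (- (l * x)) \<partial>lborel"
  have [measurable]: "k \<in> borel_measurable borel" "borel_kernel H"
    using k bk by auto
  have int: "integrable lborel (\<lambda>x. k x * exp (- (l * x)))"
  proof (rule Bochner_Integration.integrable_bound[OF k])
    show "AE x in lborel. norm (k x * exp (- (l * x))) \<le> norm (k x)"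
    proof (rule AE_I2)
      fix x
      show "norm (k x * exp (- (l * x))) \<le> norm (k x)"
        using kneg[of x] l k0[of x] by (cases "x < 0") (auto simp: mult_left_le)
    qed
  qed measurable
  have I0: "0 \<le> ?I" using k0 by (intro integral_nonneg_AE) auto
  have "(\<integral>\<^sup>+s. ennreal (norm (H t s) * exp (l * s)) \<partial>lborel) \<le> ennreal (?I * exp (l * t))" for t
  proof -
    have "(\<integral>\<^sup>+s. ennreal (norm (H t s) * exp (l * s)) \<partial>lborel)
        \<le> (\<integral>\<^sup>+s. ennreal (k (t - s) * exp (l * s)) \<partial>lborel)"
      using bd by (intro nn_integral_mono ennreal_leI mult_right_mono) auto
    also have "\<dots> = (\<integral>\<^sup>+x. ennreal (k x * exp (l * (t - x))) \<partial>lborel)"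
      by (subst nn_integral_real_affine[where c = "-1" and t = t]) auto
    also have "\<dots> = (\<integral>\<^sup>+x. ennreal (exp (l * t)) * ennreal (k x * exp (- (l * x))) \<partial>lborel)"
      using k0 by (intro nn_integral_cong)
        (simp add: ennreal_mult[symmetric] right_diff_distrib exp_diff exp_minus field_simps)
    also have "\<dots> = ennreal (exp (l * t)) * (\<integral>\<^sup>+x. ennreal (k x * exp (- (l * x))) \<partial>lborel)"
      by (intro nn_integral_cmult) measurable
    also have "(\<integral>\<^sup>+x. ennreal (k x * exp (- (l * x))) \<partial>lborel) = ennreal ?I"
      using k0 by (intro nn_integral_eq_integral int) auto
    finally show ?thesis using I0 by (simp add: ennreal_mult[symmetric] mult_ac)
  qed
  then show ?thesis using I0 bk by (simp add: row_bound_def)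
qed

text \<open>
  The case \<open>l = 0\<close>, in which the weight is constant, suffices for integrability and Fubini.
  The weight is written as \<open>exp (0 * t)\<close> so that it is an instance of the exponential weights.
\<close>

lemma ex_row_bound_unweighted:
  assumes "convolution_dominated H"
  shows "\<exists>M. weight.row_bound (\<lambda>t. exp (0 * t)) M H"
  using assms row_bound_exp[of H _ 0] unfolding convolution_dominated_def by blast

text \<open>
  By dominated convergence the Laplace transform of \<open>k\<close> tends to 0, because \<open>k\<close> vanishes on the
  negative half-line.
\<close>

lemma ex_contractive_row_bound:
  assumes "convolution_dominated H"
  shows "\<exists>l\<ge>0. \<exists>\<rho><1. weight.row_bound (\<lambda>t. exp (l * t)) \<rho> H"
proof -
  from assms obtain k where bk: "borel_kernel H" and k: "integrable lborel k" and k0: "\<And>x. 0 \<le> k x"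
    and kneg: "\<And>x. x < 0 \<Longrightarrow> k x = 0" and bd: "\<And>t s. norm (H t s) \<le> k (t - s)"
    unfolding convolution_dominated_def by blast
  have [measurable]: "k \<in> borel_measurable borel" using k by auto
  have "(\<lambda>n. \<integral>x. k x * exp (- (real n * x)) \<partial>lborel) \<longlonglongrightarrow> (\<integral>x. 0 \<partial>(lborel :: real measure))"
  proof (rule Bochner_Integration.integral_dominated_convergence[where w = k])
    have "AE x in lborel. x \<noteq> (0::real)" by (rule AE_lborel_singleton)
    then show "AE x in lborel. (\<lambda>n. k x * exp (- (real n * x))) \<longlonglongrightarrow> 0"
    proof eventually_elim
      case (elim x)
      show ?case
      proof (cases "x < 0")
        case False
        then have "x > 0" using elim by simp
        then have "(\<lambda>n. k x * exp (- x) ^ n) \<longlonglongrightarrow> k x * 0"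
          by (intro tendsto_intros LIMSEQ_realpow_zero) auto
        then show ?thesis by (simp add: exp_of_nat_mult[symmetric])
      qed (simp add: kneg)
    qed
    show "AE x in lborel. norm (k x * exp (- (real n * x))) \<le> k x" for n
    proof (rule AE_I2)
      fix x
      show "norm (k x * exp (- (real n * x))) \<le> k x"
        using kneg[of x] k0[of x] by (cases "x < 0") (auto simp: mult_left_le)
    qed
  qed (use k in measurable)
  then have "\<forall>\<^sub>F n in sequentially. (\<integral>x. k x * exp (- (real n * x)) \<partial>lborel) < 1"
    by (intro order_tendstoD) auto
  then obtain n where n: "(\<integral>x. k x * exp (- (real n * x)) \<partial>lborel) < 1"
    by (auto simp: eventually_sequentially)
  show ?thesis
    using row_bound_exp[OF bk k k0 kneg bd, of "real n"] n of_nat_0_le_iff[of n] by blast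
qed

lemma convolution_dominated_add:
  assumes "convolution_dominated H" and "convolution_dominated H'"
  shows "convolution_dominated (\<lambda>t s. H t s + H' t s)"
proof -
  from assms have [measurable]: "borel_kernel H" "borel_kernel H'"
    by (auto simp: convolution_dominated_def)
  from assms obtain k k' where
    "integrable lborel k" "\<forall>x. 0 \<le> k x" "\<forall>x<0. k x = 0" and b: "\<forall>t s. norm (H t s) \<le> k (t - s)"
    "integrable lborel k'" "\<forall>x. 0 \<le> k' x" "\<forall>x<0. k' x = 0" and b': "\<forall>t s. norm (H' t s) \<le> k' (t - s)"
    unfolding convolution_dominated_def by blast
  then have "integrable lborel (\<lambda>x. k x + k' x) \<and> (\<forall>x. 0 \<le> k x + k' x) \<and> (\<forall>x<0. k x + k' x = 0)"
    by auto
  moreover have "norm (H t s + H' t s) \<le> k (t - s) + k' (t - s)" for t s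
    using b b' by (meson add_mono norm_triangle_le)
  moreover have "borel_kernel (\<lambda>t s. H t s + H' t s)" by measurable
  ultimately show ?thesis unfolding convolution_dominated_def by blast
qed

lemma convolution_dominated_scale:
  assumes "convolution_dominated H" and p: "p \<in> borel_measurable borel" "\<And>t. norm (p t) \<le> c"
  shows "convolution_dominated (\<lambda>t s. p t * H t s)"
proof -
  from assms have [measurable]: "borel_kernel H" "p \<in> borel_measurable borel"
    by (auto simp: convolution_dominated_def)
  from assms obtain k where
    k: "integrable lborel k" "\<forall>x. 0 \<le> k x" "\<forall>x<0. k x = 0" and b: "\<forall>t s. norm (H t s) \<le> k (t - s)"
    unfolding convolution_dominated_def by blast
  have "0 \<le> c" using p(2)[of 0] norm_ge_zero[of "p 0"] by linarith
  then have "integrable lborel (\<lambda>x. c * k x) \<and> (\<forall>x. 0 \<le> c * k x) \<and> (\<forall>x<0. c * k x = 0)"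
    using k by auto
  moreover have "norm (p t * H t s) \<le> c * k (t - s)" for t s
    using b p(2)[of t] \<open>0 \<le> c\<close> by (auto simp: norm_mult intro!: mult_mono)
  moreover have "borel_kernel (\<lambda>t s. p t * H t s)" by measurable
  ultimately show ?thesis unfolding convolution_dominated_def by blast
qed

lemma convolution_dominated_sum:
  assumes "finite J" and "\<And>j. j \<in> J \<Longrightarrow> convolution_dominated (H j)"
  shows "convolution_dominated (\<lambda>t s. \<Sum>j\<in>J. H j t s)"
  using assms
proof (induction J rule: finite_induct)
  case empty
  show ?case unfolding convolution_dominated_def by (auto intro!: exI[of _ "\<lambda>_. 0"])
next
  case (insert j J)
  then show ?case using convolution_dominated_add[of "H j" "\<lambda>t s. \<Sum>j\<in>J. H j t s"] by simp
qed

lemma borel_kernel_on_triangle: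
  assumes [measurable]: "borel_kernel G"
  shows "borel_kernel (on_triangle T G)"
  unfolding on_triangle_def by measurable

lemma convolution_dominated_difference:
  assumes r: "integrable lborel r"
  shows "convolution_dominated (on_triangle T (\<lambda>t s. r (t - s)))"
proof -
  have [measurable]: "r \<in> borel_measurable borel" using r by auto
  have "borel_kernel (on_triangle T (\<lambda>t s. r (t - s)))"
    by (intro borel_kernel_on_triangle) measurable
  moreover have "integrable lborel (\<lambda>x. indicator {0..} x *\<^sub>R norm (r x))"
    by (rule integrable_mult_indicator) (use r in auto)
  ultimately show ?thesis
    unfolding convolution_dominated_def
    by (intro conjI exI[of _ "\<lambda>x. indicator {0..} x *\<^sub>R norm (r x)"])
       (auto simp: on_triangle_def indicator_def)
qed

lemma convolution_dominated_bounded: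
  assumes bk: "borel_kernel H" and bd: "\<And>t s. norm (H t s) \<le> M"
    and supp: "\<And>t s. \<not> (0 \<le> s \<and> s \<le> t \<and> t \<le> T) \<Longrightarrow> H t s = 0"
  shows "convolution_dominated H"
proof -
  have "0 \<le> M" using bd[of 0 0] norm_ge_zero[of "H 0 0"] by linarith
  have "integrable lborel (\<lambda>x. indicator {0..T} x *\<^sub>R M)"
    by (intro integrable_scaleR_left integrable_real_indicator) (auto simp: emeasure_lborel_Icc_eq)
  moreover have "norm (H t s) \<le> indicator {0..T} (t - s) *\<^sub>R M" for t s
    using bd[of t s] supp[of s t] by (auto simp: indicator_def)
  ultimately show ?thesis
    using bk \<open>0 \<le> M\<close> unfolding convolution_dominated_def
    by (intro conjI exI[of _ "\<lambda>x. indicator {0..T} x *\<^sub>R M"]) auto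
qed

text \<open>
  A bounded kernel smooths an integrable one: the composition is bounded by \<open>M\<close> times the
  integral of \<open>\<bar>r\<bar>\<close>.
\<close>

lemma convolution_dominated_kernel_comp:
  assumes K: "borel_kernel K" "\<And>t s. norm (K t s) \<le> M"
      "\<And>t s. \<not> (0 \<le> s \<and> s \<le> t \<and> t \<le> T) \<Longrightarrow> K t s = 0"
    and r: "integrable lborel r"
  shows "convolution_dominated (kernel_comp K (on_triangle T (\<lambda>t s. r (t - s))))"
proof (rule convolution_dominated_bounded)
  let ?C = "on_triangle T (\<lambda>t s. r (t - s))"
  have [measurable]: "r \<in> borel_measurable borel" using r by auto
  have M: "0 \<le> M" using K(2)[of 0 0] norm_ge_zero[of "K 0 0"] by linarith
  have C: "borel_kernel ?C" by (intro borel_kernel_on_triangle) measurable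
  with K(1) show "borel_kernel (kernel_comp K ?C)" by (rule borel_kernel_comp)
  fix t s
  note [measurable] = C K(1)
  have int: "integrable lborel (\<lambda>\<xi>. M * norm (r (\<xi> - s)))"
    using lborel_integrable_real_affine[OF r, of 1 "- s"] by auto
  show "norm (kernel_comp K ?C t s) \<le> M * (\<integral>x. norm (r x) \<partial>lborel)"
  proof -
    have "norm (kernel_comp K ?C t s) \<le> (\<integral>\<xi>. M * norm (r (\<xi> - s)) \<partial>lborel)"
      unfolding kernel_comp_def
    proof (rule Bochner_Integration.integral_norm_bound_integral)
      show "norm (K t \<xi> * ?C \<xi> s) \<le> M * norm (r (\<xi> - s))" for \<xi>
        using K(2)[of t \<xi>] M by (auto simp: norm_mult on_triangle_def intro!: mult_right_mono)
      then show "integrable lborel (\<lambda>\<xi>. K t \<xi> * ?C \<xi> s)"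
        using M by (intro Bochner_Integration.integrable_bound[OF int]) auto
    qed (rule int)
    also have "\<dots> = M * (\<integral>x. norm (r x) \<partial>lborel)"
      by (subst (2) lborel_integral_real_affine[where c = 1 and t = "- s"]) auto
    finally show ?thesis .
  qed
  show "kernel_comp K ?C t s = 0" if "\<not> (0 \<le> s \<and> s \<le> t \<and> t \<le> T)"
  proof -
    have "K t \<xi> * ?C \<xi> s = 0" for \<xi>
      using that K(3)[of \<xi> t] by (auto simp: on_triangle_def)
    then show ?thesis by (simp only: kernel_comp_def Bochner_Integration.integral_zero)
  qed
qed

section \<open>Continuity of the Volterra integrals\<close>

lemma C0T_borel:
  assumes "f \<in> C0T T"
  shows "f \<in> borel_measurable borel"
proof -
  have "(\<lambda>t. indicator {0..T} t *\<^sub>R f t) \<in> borel_measurable borel"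
    using assms by (intro borel_measurable_continuous_on_indicator) (auto simp: C0T_def)
  also have "(\<lambda>t. indicator {0..T} t *\<^sub>R f t) = f"
    using assms by (force simp: C0T_def indicator_def)
  finally show ?thesis .
qed

lemma C0T_bounded:
  assumes "f \<in> C0T T"
  obtains c where "0 \<le> c" and "\<And>t. norm (f t) \<le> c"
proof -
  have "bounded (f ` {0..T})"
    using assms by (intro compact_imp_bounded compact_continuous_image) (auto simp: C0T_def)
  then obtain c where c: "0 < c" "\<And>t. t \<in> {0..T} \<Longrightarrow> norm (f t) \<le> c"
    by (auto simp: bounded_pos)
  have "norm (f t) \<le> c" for t
    using c assms by (cases "t \<in> {0..T}") (auto simp: C0T_def)
  then show ?thesis using that[of c] c(1) by simp
qed

lemma C0T_dominated:
  assumes "f \<in> C0T T" and "0 \<le> l"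
  obtains c where "weight.dominated (\<lambda>t. exp (l * t)) c f"
proof -
  interpret weight "\<lambda>t. exp (l * t)" by (rule weight_exp)
  obtain c where c: "0 \<le> c" "\<And>t. norm (f t) \<le> c" using C0T_bounded[OF assms(1)] by blast
  have "norm (f t) \<le> c * exp (l * t)" for t
  proof (cases "t \<in> {0..T}")
    case True
    then have "c * 1 \<le> c * exp (l * t)" using c(1) assms(2) by (intro mult_left_mono) auto
    then show ?thesis using c(2)[of t] by simp
  next
    case False
    then show ?thesis using assms(1) c(1) by (simp add: C0T_def)
  qed
  then show ?thesis
    using that c(1) C0T_borel[OF assms(1)] by (auto simp: dominated_def)
qed

lemma C0T_add: "f \<in> C0T T \<Longrightarrow> g \<in> C0T T \<Longrightarrow> (\<lambda>t. f t + g t) \<in> C0T T"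
  and C0T_diff: "f \<in> C0T T \<Longrightarrow> g \<in> C0T T \<Longrightarrow> (\<lambda>t. f t - g t) \<in> C0T T"
  and C0T_mult: "f \<in> C0T T \<Longrightarrow> g \<in> C0T T \<Longrightarrow> (\<lambda>t. f t * g t) \<in> C0T T"
  by (auto simp: C0T_def intro!: continuous_on_add continuous_on_diff continuous_on_mult)

lemma C0T_sum: "finite J \<Longrightarrow> (\<And>j. j \<in> J \<Longrightarrow> f j \<in> C0T T) \<Longrightarrow> (\<lambda>t. \<Sum>j\<in>J. f j t) \<in> C0T T"
  by (auto simp: C0T_def intro!: continuous_on_sum)

lemma continuous_on_integral_dominated:
  fixes h :: "real \<Rightarrow> real \<Rightarrow> complex"
  assumes meas: "\<And>t. t \<in> A \<Longrightarrow> h t \<in> borel_measurable M"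
    and w: "integrable M w" and bd: "\<And>t x. t \<in> A \<Longrightarrow> norm (h t x) \<le> w x"
    and cont: "\<And>t. t \<in> A \<Longrightarrow> AE x in M. continuous (at t within A) (\<lambda>t. h t x)"
  shows "continuous_on A (\<lambda>t. \<integral>x. h t x \<partial>M)"
  unfolding continuous_on_eq_continuous_within
proof
  fix t assume t: "t \<in> A"
  show "continuous (at t within A) (\<lambda>t. \<integral>x. h t x \<partial>M)"
    unfolding continuous_within_sequentially o_def
  proof (intro allI impI)
    fix u :: "nat \<Rightarrow> real" assume u: "(\<forall>n. u n \<in> A) \<and> u \<longlonglongrightarrow> t"
    show "(\<lambda>n. \<integral>x. h (u n) x \<partial>M) \<longlonglongrightarrow> (\<integral>x. h t x \<partial>M)"
    proof (rule Bochner_Integration.integral_dominated_convergence[OF _ _ w])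
      show "AE x in M. (\<lambda>n. h (u n) x) \<longlonglongrightarrow> h t x"
        using cont[OF t]
      proof eventually_elim
        case (elim x)
        then show ?case using u unfolding continuous_within_sequentially o_def by blast
      qed
    qed (use meas bd u t in auto)
  qed
qed

text \<open>
  The extension of \<open>v\<close> by 0 may jump at 0, and this is the only discontinuity of \<open>v (t - x)\<close> as long as \<open>t - x\<close>
  does not exceed \<open>T\<close>; it is met only for \<open>x = t\<close>.
\<close>

lemma C0T_continuous_within:
  assumes v: "v \<in> C0T T" and t: "t \<in> {0..T}" and x: "x \<noteq> t" "0 \<le> x"
  shows "continuous (at t within {0..T}) (\<lambda>t. v (t - x))"
proof (cases "x < t")
  case True
  \<comment> \<open>Clamping at 0 keeps the argument where \<open>v\<close> is continuous and changes nothing near \<open>u = t\<close>.\<close>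
  have "continuous_on {0..T} (\<lambda>u. v (max 0 (u - x)))"
  proof (rule continuous_on_compose2[of "{0..T}" v _ "\<lambda>u. max 0 (u - x)"])
    show "continuous_on {0..T} v" using v by (simp add: C0T_def)
    show "continuous_on {0..T} (\<lambda>u. max 0 (u - x))" by (intro continuous_intros)
    show "(\<lambda>u. max 0 (u - x)) ` {0..T} \<subseteq> {0..T}" using x by auto
  qed
  then have "((\<lambda>u. v (max 0 (u - x))) \<longlongrightarrow> v (max 0 (t - x))) (at t within {0..T})"
    using t unfolding continuous_on_def by blast
  then have "((\<lambda>u. v (max 0 (u - x))) \<longlongrightarrow> v (t - x)) (at t within {0..T})"
    using True by (simp add: max_def)
  moreover have "\<forall>\<^sub>F u in at t within {0..T}. v (max 0 (u - x)) = v (u - x)"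
    using order_tendstoD(1)[OF tendsto_ident_at True] by eventually_elim (simp add: max_def)
  ultimately show ?thesis
    unfolding continuous_within by (rule Lim_transform_eventually)
next
  case False
  then have "t < x" using x by simp
  have "\<forall>\<^sub>F u in at t within {0..T}. v (u - x) = v (t - x)"
    using order_tendstoD(2)[OF tendsto_ident_at \<open>t < x\<close>]
  proof eventually_elim
    case (elim u)
    then show ?case using v \<open>t < x\<close> by (simp add: C0T_def)
  qed
  then show ?thesis
    unfolding continuous_within by (rule tendsto_eventually)
qed

lemma kernel_op_on_triangle_outside:
  assumes "t \<notin> {0..T}"
  shows "kernel_op (on_triangle T G) f t = 0"
proof -
  have "on_triangle T G t s = 0" for s using assms by (auto simp: on_triangle_def)
  then show ?thesis by (simp add: kernel_op_def)
qed

text \<open>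
  After the substitution \<open>x = t - s\<close> the variable \<open>t\<close> occurs only in the continuous factor,
  so dominated convergence with majorant \<open>c \<bar>q x\<bar>\<close> applies although \<open>q\<close> itself may be
  discontinuous and unbounded.
\<close>

lemma kernel_op_difference_in_C0T:
  assumes q: "integrable lborel q" and q0: "\<And>x. x \<notin> {0<..<T} \<Longrightarrow> q x = 0" and v: "v \<in> C0T T"
  shows "kernel_op (on_triangle T (\<lambda>t s. q (t - s))) v \<in> C0T T"
proof -
  let ?C = "on_triangle T (\<lambda>t s. q (t - s))"
  have [measurable]: "q \<in> borel_measurable borel" "v \<in> borel_measurable borel"
    using q C0T_borel[OF v] by auto
  obtain c where c: "\<And>t. norm (v t) \<le> c" using C0T_bounded[OF v] by blast
  have eq: "kernel_op ?C v t = (\<integral>x. q x * v (t - x) \<partial>lborel)" if t: "t \<in> {0..T}" for t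
  proof -
    have "?C t s * v s = q (t - s) * v s" for s
      using v t q0[of "t - s"] by (auto simp: on_triangle_def C0T_def)
    then have "kernel_op ?C v t = (\<integral>s. q (t - s) * v s \<partial>lborel)"
      by (simp only: kernel_op_def)
    also have "\<dots> = (\<integral>x. q x * v (t - x) \<partial>lborel)"
      by (subst lborel_integral_real_affine[where c = "-1" and t = t]) auto
    finally show ?thesis .
  qed
  have "continuous_on {0..T} (\<lambda>t. \<integral>x. q x * v (t - x) \<partial>lborel)"
  proof (rule continuous_on_integral_dominated)
    show "integrable lborel (\<lambda>x. norm (q x) * c)" using q by auto
    show "norm (q x * v (t - x)) \<le> norm (q x) * c" for t x
      using c by (auto simp: norm_mult intro!: mult_left_mono)
    fix t assume t: "t \<in> {0..T}"
    have "AE x in lborel. x \<noteq> t" by (rule AE_lborel_singleton)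
    then show "AE x in lborel. continuous (at t within {0..T}) (\<lambda>t. q x * v (t - x))"
    proof eventually_elim
      case (elim x)
      show ?case
      proof (cases "x \<in> {0<..<T}")
        case True
        then have "continuous (at t within {0..T}) (\<lambda>t. v (t - x))"
          using elim by (intro C0T_continuous_within[OF v t]) auto
        then show ?thesis by (intro continuous_mult continuous_const)
      qed (simp add: q0)
    qed
  qed measurable
  moreover have "continuous_on {0..T} (kernel_op ?C v) \<longleftrightarrow>
      continuous_on {0..T} (\<lambda>t. \<integral>x. q x * v (t - x) \<partial>lborel)"
    by (intro continuous_on_cong refl eq)
  ultimately have "continuous_on {0..T} (kernel_op ?C v)" by blast
  then show ?thesis
    by (simp add: C0T_def kernel_op_on_triangle_outside)
qed

lemma compact_triangle: "compact {(t, s). 0 \<le> s \<and> s \<le> t \<and> t \<le> (T::real)}"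
  unfolding compact_eq_bounded_closed
proof
  show "bounded {(t, s). 0 \<le> s \<and> s \<le> t \<and> t \<le> T}"
    by (rule bounded_subset[of "{0..T} \<times> {0..T}"]) (auto intro: bounded_Times)
  show "closed {(t, s). 0 \<le> s \<and> s \<le> t \<and> t \<le> T}"
    unfolding case_prod_beta
    by (intro closed_Collect_conj closed_Collect_le continuous_intros)
qed

context
  fixes T :: real and K :: "real \<Rightarrow> real \<Rightarrow> complex"
  assumes K: "continuous_on {(t, s). 0 \<le> s \<and> s \<le> t \<and> t \<le> T} (\<lambda>(t, s). K t s)"
begin

lemma borel_kernel_on_triangle_continuous: "borel_kernel (on_triangle T K)"
proof -
  let ?D = "{(t, s). 0 \<le> s \<and> s \<le> t \<and> t \<le> T}"
  have "(\<lambda>z. indicator ?D z *\<^sub>R (\<lambda>(t, s). K t s) z) \<in> borel_measurable borel"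
    using K compact_imp_closed[OF compact_triangle[of T]]
    by (intro borel_measurable_continuous_on_indicator) auto
  also have "(\<lambda>z. indicator ?D z *\<^sub>R (\<lambda>(t, s). K t s) z) = case_prod (on_triangle T K)"
    by (auto simp: fun_eq_iff on_triangle_def)
  finally show ?thesis by (simp add: borel_prod)
qed

lemma on_triangle_bounded: "\<exists>M. \<forall>t s. norm (on_triangle T K t s) \<le> M"
proof -
  let ?D = "{(t, s). 0 \<le> s \<and> s \<le> t \<and> t \<le> T}"
  have "bounded ((\<lambda>(t, s). K t s) ` ?D)"
    using K compact_triangle by (intro compact_imp_bounded compact_continuous_image)
  then obtain M where M: "0 < M" "\<And>z. z \<in> ?D \<Longrightarrow> norm ((\<lambda>(t, s). K t s) z) \<le> M"
    unfolding bounded_pos by blast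
  then have "norm (on_triangle T K t s) \<le> M" for t s
    using M(2)[of "(t, s)"] by (auto simp: on_triangle_def)
  then show ?thesis by blast
qed

lemma convolution_dominated_continuous: "convolution_dominated (on_triangle T K)"
proof -
  obtain M where "\<And>t s. norm (on_triangle T K t s) \<le> M" using on_triangle_bounded by blast
  then show ?thesis
    by (rule convolution_dominated_bounded[OF borel_kernel_on_triangle_continuous]) (auto simp: on_triangle_def)
qed

lemma continuous_on_triangle_within:
  assumes t: "t \<in> {0..T}" and s: "s \<noteq> t"
  shows "continuous (at t within {0..T}) (\<lambda>t. on_triangle T K t s)"
proof -
  consider "s < 0" | "t < s" | "0 \<le> s" "s < t" using s by linarith
  then show ?thesis
  proof cases
    case 1
    then show ?thesis by (simp add: on_triangle_def)
  next
    case 2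
    have "\<forall>\<^sub>F u in at t within {0..T}. on_triangle T K u s = on_triangle T K t s"
      using order_tendstoD(2)[OF tendsto_ident_at 2]
      by eventually_elim (use 2 in \<open>simp add: on_triangle_def\<close>)
    then show ?thesis unfolding continuous_within by (rule tendsto_eventually)
  next
    case 3
    \<comment> \<open>For \<open>u < s\<close> the point \<open>(u, s)\<close> lies outside the triangle; clamping moves it to the diagonal.\<close>
    let ?m = "\<lambda>u. (max s u, s)"
    have "continuous_on {0..T} (\<lambda>u. (\<lambda>(t, s). K t s) (?m u))"
    proof (rule continuous_on_compose2[OF K, of _ ?m])
      show "continuous_on {0..T} ?m" by (intro continuous_intros)
      show "?m ` {0..T} \<subseteq> {(t, s). 0 \<le> s \<and> s \<le> t \<and> t \<le> T}" using 3 t by auto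
    qed
    then have "((\<lambda>u. K (max s u) s) \<longlongrightarrow> K (max s t) s) (at t within {0..T})"
      using t unfolding continuous_on_def by simp
    then have "((\<lambda>u. K (max s u) s) \<longlongrightarrow> on_triangle T K t s) (at t within {0..T})"
      using 3 t by (simp add: on_triangle_def max_def)
    moreover have "\<forall>\<^sub>F u in at t within {0..T}. u \<in> {0..T}"
      by (simp add: eventually_at_filter)
    then have "\<forall>\<^sub>F u in at t within {0..T}. K (max s u) s = on_triangle T K u s"
      using order_tendstoD(1)[OF tendsto_ident_at 3(2)]
      by eventually_elim (use 3 in \<open>simp add: on_triangle_def max_def\<close>)
    ultimately show ?thesis
      unfolding continuous_within by (rule Lim_transform_eventually)
  qed
qed

lemma kernel_op_continuous_in_C0T:
  assumes v: "v \<in> C0T T"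
  shows "kernel_op (on_triangle T K) v \<in> C0T T"
proof -
  have [measurable]: "borel_kernel (on_triangle T K)" "v \<in> borel_measurable borel"
    using borel_kernel_on_triangle_continuous C0T_borel[OF v] by auto
  obtain c where c: "0 \<le> c" "\<And>t. norm (v t) \<le> c" using C0T_bounded[OF v] by blast
  obtain M where M: "\<And>t s. norm (on_triangle T K t s) \<le> M" using on_triangle_bounded by blast
  have M0: "0 \<le> M" using M[of 0 0] norm_ge_zero[of "on_triangle T K 0 0"] by linarith
  have "continuous_on {0..T} (kernel_op (on_triangle T K) v)"
    unfolding kernel_op_def
  proof (rule continuous_on_integral_dominated)
    show "integrable lborel (\<lambda>s. indicator {0..T} s *\<^sub>R (M * c))"
      by (intro integrable_scaleR_left integrable_real_indicator) (auto simp: emeasure_lborel_Icc_eq)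
    show "norm (on_triangle T K t s * v s) \<le> indicator {0..T} s *\<^sub>R (M * c)" for t s
      using v M[of t s] c M0 by (cases "s \<in> {0..T}") (auto simp: norm_mult C0T_def intro!: mult_mono)
    fix t assume t: "t \<in> {0..T}"
    have "AE s in lborel. s \<noteq> t" by (rule AE_lborel_singleton)
    then show "AE s in lborel. continuous (at t within {0..T}) (\<lambda>t. on_triangle T K t s * v s)"
      by eventually_elim (intro continuous_mult continuous_const continuous_on_triangle_within t)
  qed measurable
  then show ?thesis
    by (simp add: C0T_def kernel_op_on_triangle_outside)
qed

end

section \<open>Volterra equations of the second kind in C[0,T]\<close>

text \<open>
  All functions in C[0,T] are dominated by each weight \<open>exp (l t)\<close> with \<open>l \<ge> 0\<close>, so \<open>l\<close> can be
  chosen to make the operator a contraction. On the compact interval weighted convergence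
  is uniform convergence, which keeps the solution continuous.
\<close>

lemma second_kind_equation_C0T:
  assumes H: "convolution_dominated H" and maps: "kernel_op H ` C0T T \<subseteq> C0T T"
    and g: "g \<in> C0T T"
  defines "x \<equiv> (\<lambda>t. g t - kernel_op (neumann_kernel H) g t)"
  shows "x \<in> C0T T" and "x t + kernel_op H x t = g t"
    and "\<And>v. v \<in> C0T T \<Longrightarrow> (\<And>t. v t + kernel_op H v t = g t) \<Longrightarrow> v = x"
proof -
  obtain l \<rho> where l: "0 \<le> l" and \<rho>: "\<rho> < 1" and rb: "weight.row_bound (\<lambda>t. exp (l * t)) \<rho> H"
    using ex_contractive_row_bound[OF H] by blast
  interpret weight "\<lambda>t. exp (l * t)" by (rule weight_exp)
  obtain c where c: "dominated c g" using C0T_dominated[OF g l] by blast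
  have pow: "(kernel_op H ^^ Suc n) g \<in> C0T T" for n
    by (induction n) (use maps g in auto)
  have "continuous_on {0..T} (kernel_op (neumann_kernel H) g)"
  proof (rule continuous_on_kernel_op_neumann_kernel[OF rb \<rho> c])
    show "exp (l * t) \<le> exp (l * T)" if "t \<in> {0..T}" for t
      using that l by (auto intro: mult_left_mono)
    show "continuous_on {0..T} ((kernel_op H ^^ Suc n) g)" for n
      using pow by (auto simp: C0T_def)
  qed
  moreover have "kernel_op (neumann_kernel H) g t = 0" if "t \<notin> {0..T}" for t
  proof -
    have "(\<lambda>n. 0) sums kernel_op (neumann_kernel H) g t"
      using kernel_op_neumann_kernel_sums[OF rb \<rho> c, of t] pow that
      by (simp add: C0T_def del: funpow.simps)
    then show ?thesis using sums_unique2 sums_zero by blast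
  qed
  ultimately have "kernel_op (neumann_kernel H) g \<in> C0T T"
    unfolding C0T_def by auto
  then show x: "x \<in> C0T T" unfolding x_def by (intro C0T_diff g)
  show eq: "x t + kernel_op H x t = g t" for t
    unfolding x_def by (rule neumann_right_inverse[OF rb \<rho> c])
  fix v assume v: "v \<in> C0T T" and "\<And>t. v t + kernel_op H v t = g t"
  moreover obtain a where "dominated a x" using C0T_dominated[OF x l] by blast
  moreover obtain b where "dominated b v" using C0T_dominated[OF v l] by blast
  ultimately show "v = x"
    using one_plus_kernel_op_injective[OF rb \<rho>] eq by metis
qed

lemma integrable_kernel_C0T:
  assumes "convolution_dominated H" and "v \<in> C0T T"
  shows "integrable lborel (\<lambda>s. H t s * v s)"
proof -
  interpret weight "\<lambda>t. exp (0 * t)" by (rule weight_exp)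
  show ?thesis
    using ex_row_bound_unweighted[OF assms(1)] C0T_dominated[OF assms(2) order_refl]
      integrable_kernel_apply by metis
qed

lemma kernel_op_kernel_comp_C0T:
  assumes "convolution_dominated H" and "convolution_dominated H'" and "v \<in> C0T T"
  shows "kernel_op (kernel_comp H H') v t = kernel_op H (kernel_op H' v) t"
proof -
  interpret weight "\<lambda>t. exp (0 * t)" by (rule weight_exp)
  show ?thesis
    using ex_row_bound_unweighted[OF assms(1)] ex_row_bound_unweighted[OF assms(2)]
      C0T_dominated[OF assms(3) order_refl] kernel_op_kernel_comp by metis
qed

section \<open>Borel representatives of the kernels\<close>

text \<open>
  The representative is made to vanish exactly, not just almost everywhere, outside the
  open interval: then \<open>r' (t - s)\<close> vanishes for \<open>s > t\<close>.
\<close>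

lemma ex_borel_representative:
  fixes r :: "real \<Rightarrow> complex"
  assumes "set_integrable lebesgue {0<..<T} r"
  obtains r' where "integrable lborel r'" and "\<And>x. x \<notin> {0<..<T} \<Longrightarrow> r' x = 0"
    and "AE x in lborel. x \<in> {0<..<T} \<longrightarrow> r x = r' x"
proof -
  define F where "F = (\<lambda>x. indicator {0<..<T} x *\<^sub>R r x)"
  have F: "integrable lebesgue F"
    using assms unfolding set_integrable_def F_def .
  then have "(\<lambda>x. Re (F x)) \<in> borel_measurable lebesgue" "(\<lambda>x. Im (F x)) \<in> borel_measurable lebesgue"
    by auto
  then obtain a b where [measurable]: "a \<in> borel_measurable lborel" "b \<in> borel_measurable lborel"
    and ae: "AE x in lborel. Re (F x) = a x" "AE x in lborel. Im (F x) = b x"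
    using completion_ex_borel_measurable_real by blast
  define r' where "r' x = indicator {0<..<T} x *\<^sub>R (complex_of_real (a x) + \<i> * complex_of_real (b x))" for x
  have [measurable]: "r' \<in> borel_measurable lborel"
    unfolding r'_def by measurable
  have eq: "AE x in lborel. F x = r' x"
    using ae
  proof eventually_elim
    case (elim x)
    then have "complex_of_real (a x) + \<i> * complex_of_real (b x) = F x"
      by (simp add: complex_eq_iff)
    then show ?case by (simp add: r'_def F_def indicator_def split: if_splits)
  qed
  have "integrable lebesgue r'"
    using F AE_completion[OF eq] measurable_completion[of r' lborel borel]
    by (subst integrable_cong_AE[of r' lebesgue F]) auto
  then have "integrable lborel r'" by (simp add: integrable_completion)
  moreover have "AE x in lborel. x \<in> {0<..<T} \<longrightarrow> r x = r' x"
    using eq by eventually_elim (auto simp: F_def)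
  ultimately show ?thesis using that by (auto simp: r'_def)
qed

text \<open>
  The exceptional set is enlarged to a Borel null set first, because \<open>P\<close> need not be measurable.
\<close>

lemma AE_lborel_affine:
  fixes P :: "real \<Rightarrow> bool"
  assumes "AE x in lborel. P x" and "c \<noteq> 0"
  shows "AE x in lborel. P (t + c * x)"
proof -
  obtain N where N: "{x \<in> space lborel. \<not> P x} \<subseteq> N" "emeasure lborel N = 0" "N \<in> sets lborel"
    by (rule AE_E[OF assms(1)])
  have "AE x in lborel. x \<notin> N" using N by (intro AE_not_in) (auto simp: null_sets_def)
  moreover have "Measurable.pred borel (\<lambda>x. x \<notin> N)" using N(3) by simp
  ultimately have "AE x in lborel. t + c * x \<notin> N"
    using AE_borel_affine[OF assms(2)] by blast
  then show ?thesis by eventually_elim (use N(1) in auto)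
qed

lemma difference_kernel_ae_eq:
  fixes r r' :: "real \<Rightarrow> complex"
  assumes "AE x in lborel. x \<in> {0<..<T} \<longrightarrow> r x = r' x"
  shows "ae_kernel_eq (on_triangle T (\<lambda>t s. r (t - s))) (on_triangle T (\<lambda>t s. r' (t - s)))"
proof -
  \<comment> \<open>The closed triangle includes \<open>t - s = 0\<close> and \<open>t - s = T\<close>, where nothing is known about \<open>r\<close>.\<close>
  have "AE x in lborel. x \<noteq> 0" "AE x in lborel. x \<noteq> T"
    by (rule AE_lborel_singleton)+
  with assms have ae: "AE x in lborel. 0 \<le> x \<longrightarrow> x \<le> T \<longrightarrow> r x = r' x"
    by eventually_elim auto
  show ?thesis
    unfolding ae_kernel_eq_def
  proof safe
    fix t
    show "AE s in lborel. on_triangle T (\<lambda>t s. r (t - s)) t s = on_triangle T (\<lambda>t s. r' (t - s)) t s"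
      using AE_lborel_affine[OF ae, of "-1" t] by (auto simp: on_triangle_def elim!: AE_mp)
  next
    fix s
    show "AE t in lborel. on_triangle T (\<lambda>t s. r (t - s)) t s = on_triangle T (\<lambda>t s. r' (t - s)) t s"
      using AE_lborel_affine[OF ae, of "1" "- s"] by (auto simp: on_triangle_def elim!: AE_mp)
  qed
qed

lemma kernel_op_add_C0T:
  assumes "convolution_dominated H" and "f \<in> C0T T" and "g \<in> C0T T"
  shows "kernel_op H (\<lambda>s. f s + g s) t = kernel_op H f t + kernel_op H g t"
  using integrable_kernel_C0T[OF assms(1,2), of t] integrable_kernel_C0T[OF assms(1,3), of t]
  by (simp add: kernel_op_def distrib_left)

lemma kernel_op_diff_C0T:
  assumes "convolution_dominated H" and "f \<in> C0T T" and "g \<in> C0T T"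
  shows "kernel_op H (\<lambda>s. f s - g s) t = kernel_op H f t - kernel_op H g t"
  using integrable_kernel_C0T[OF assms(1,2), of t] integrable_kernel_C0T[OF assms(1,3), of t]
  by (simp add: kernel_op_def right_diff_distrib)

lemma conv_op_borel_kernel:
  assumes "weakly_singular T r"
  obtains r' where "integrable lborel r'"
    and "ae_kernel_eq (on_triangle T (\<lambda>t s. r (t - s))) (on_triangle T (\<lambda>t s. r' (t - s)))"
    and "\<And>v. v \<in> C0T T \<Longrightarrow> conv_op T r v = kernel_op (on_triangle T (\<lambda>t s. r' (t - s))) v"
    and "\<And>v. v \<in> C0T T \<Longrightarrow> kernel_op (on_triangle T (\<lambda>t s. r' (t - s))) v \<in> C0T T"
proof -
  from assms obtain r' where r': "integrable lborel r'" "\<And>x. x \<notin> {0<..<T} \<Longrightarrow> r' x = 0"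
    "AE x in lborel. x \<in> {0<..<T} \<longrightarrow> r x = r' x"
    using ex_borel_representative unfolding weakly_singular_def by metis
  let ?C = "on_triangle T (\<lambda>t s. r' (t - s))"
  have ae: "ae_kernel_eq (on_triangle T (\<lambda>t s. r (t - s))) ?C"
    by (rule difference_kernel_ae_eq[OF r'(3)])
  have bk: "borel_kernel ?C"
    using convolution_dominated_difference[OF r'(1)] by (simp add: convolution_dominated_def)
  show ?thesis
  proof (rule that[OF r'(1) ae])
    show "conv_op T r v = kernel_op ?C v" if "v \<in> C0T T" for v
      unfolding conv_op_def by (rule volterra_eq_kernel_op[OF bk ae C0T_borel[OF that]])
    show "kernel_op ?C v \<in> C0T T" if "v \<in> C0T T" for v
      by (rule kernel_op_difference_in_C0T[OF r'(1,2) that])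
  qed
qed

section \<open>The block factorization and the solution\<close>

lemma direct_sum_components:
  assumes sub: "cfun.subspace S" and SC: "S \<subseteq> C0T T"
    and ws: "weakly_singular T r" and inj: "inj_on (conv_op T r) (C0T T)"
    and dir: "S \<inter> conv_op T r ` C0T T = {0}"
    and P: "P \<in> S" "P' \<in> S" and v: "v \<in> C0T T" "v' \<in> C0T T"
    and eq: "P + conv_op T r v = P' + conv_op T r v'"
  shows "P = P'" and "v = v'"
proof -
  obtain r' where r': "integrable lborel r'"
    and R: "\<And>v. v \<in> C0T T \<Longrightarrow> conv_op T r v = kernel_op (on_triangle T (\<lambda>t s. r' (t - s))) v"
    using conv_op_borel_kernel[OF ws] by metis
  have "conv_op T r (\<lambda>t. v t - v' t) = conv_op T r v - conv_op T r v'"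
    using kernel_op_diff_C0T[OF convolution_dominated_difference[OF r'] v]
    by (simp add: R v C0T_diff fun_eq_iff)
  also have "\<dots> = P' - P"
    using eq by (simp add: fun_eq_iff algebra_simps)
  finally have "P' - P \<in> conv_op T r ` C0T T"
    using C0T_diff[OF v] by (metis imageI)
  moreover have "P' - P \<in> S" using cfun.subspace_diff[OF sub P(2,1)] .
  ultimately have "P' - P = 0" using dir by blast
  then show "P = P'" by simp
  with eq have "conv_op T r v = conv_op T r v'" by simp
  with inj v show "v = v'" by (meson inj_onD)
qed

text \<open>
  The representative is \<open>\<Sum>\<^sub>j p\<^sub>j(t) q'\<^sub>j(t - s)\<close> plus the composition of \<open>K\<close> with
  \<open>r'(t - s)\<close>. The integral in \<open>G_L\<close> is such a composition, and the operator of a composed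
  kernel is the composition of the operators; this produces the term \<open>V\<^sub>K (R v)\<close>.
\<close>

lemma G_L_borel_representative:
  assumes r: "weakly_singular T r"
    and q: "\<And>j. j \<in> {1..N} \<Longrightarrow> weakly_singular T (q j)"
    and p: "\<And>j. j \<in> {1..N} \<Longrightarrow> p j \<in> C0T T"
    and K: "continuous_on {(t, s). 0 \<le> s \<and> s \<le> t \<and> t \<le> T} (\<lambda>(t, s). K t s)"
  obtains H where "convolution_dominated H"
    and "ae_kernel_eq (on_triangle T (G_L r N q p K)) H"
    and "\<And>v. v \<in> C0T T \<Longrightarrow> kernel_op H v \<in> C0T T"
    and "\<And>v t. v \<in> C0T T \<Longrightarrow>
      kernel_op H v t = (\<Sum>j=1..N. p j t * conv_op T (q j) v t) + volterra T K (conv_op T r v) t"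
proof -
  obtain r' where r': "integrable lborel r'"
    and rae: "ae_kernel_eq (on_triangle T (\<lambda>t s. r (t - s))) (on_triangle T (\<lambda>t s. r' (t - s)))"
    and R: "\<And>v. v \<in> C0T T \<Longrightarrow> conv_op T r v = kernel_op (on_triangle T (\<lambda>t s. r' (t - s))) v"
    and RC: "\<And>v. v \<in> C0T T \<Longrightarrow> kernel_op (on_triangle T (\<lambda>t s. r' (t - s))) v \<in> C0T T"
    by (rule conv_op_borel_kernel[OF r]) blast
  have "\<forall>j\<in>{1..N}. \<exists>q'. integrable lborel q' \<and>
      ae_kernel_eq (on_triangle T (\<lambda>t s. q j (t - s))) (on_triangle T (\<lambda>t s. q' (t - s))) \<and>
      (\<forall>v\<in>C0T T. conv_op T (q j) v = kernel_op (on_triangle T (\<lambda>t s. q' (t - s))) v) \<and>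
      (\<forall>v\<in>C0T T. kernel_op (on_triangle T (\<lambda>t s. q' (t - s))) v \<in> C0T T)"
  proof
    fix j assume "j \<in> {1..N}"
    from q[OF this] show "\<exists>q'. integrable lborel q' \<and>
      ae_kernel_eq (on_triangle T (\<lambda>t s. q j (t - s))) (on_triangle T (\<lambda>t s. q' (t - s))) \<and>
      (\<forall>v\<in>C0T T. conv_op T (q j) v = kernel_op (on_triangle T (\<lambda>t s. q' (t - s))) v) \<and>
      (\<forall>v\<in>C0T T. kernel_op (on_triangle T (\<lambda>t s. q' (t - s))) v \<in> C0T T)"
      by (rule conv_op_borel_kernel) blast
  qed
  then obtain q' where q': "\<And>j. j \<in> {1..N} \<Longrightarrow> integrable lborel (q' j)"
    and qae: "\<And>j. j \<in> {1..N} \<Longrightarrow> ae_kernel_eq (on_triangle T (\<lambda>t s. q j (t - s)))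
        (on_triangle T (\<lambda>t s. q' j (t - s)))"
    and Q: "\<And>j v. j \<in> {1..N} \<Longrightarrow> v \<in> C0T T \<Longrightarrow>
        conv_op T (q j) v = kernel_op (on_triangle T (\<lambda>t s. q' j (t - s))) v"
    and QC: "\<And>j v. j \<in> {1..N} \<Longrightarrow> v \<in> C0T T \<Longrightarrow>
        kernel_op (on_triangle T (\<lambda>t s. q' j (t - s))) v \<in> C0T T"
    by (subst (asm) bchoice_iff) blast
  let ?C = "on_triangle T (\<lambda>t s. r' (t - s))"
  let ?Q = "\<lambda>j. on_triangle T (\<lambda>t s. q' j (t - s))"
  let ?K = "on_triangle T K"
  let ?A = "\<lambda>t s. \<Sum>j=1..N. p j t * ?Q j t s"
  let ?B = "kernel_comp ?K ?C"
  define H where "H t s = ?A t s + ?B t s" for t s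
  have bK: "borel_kernel ?K" by (rule borel_kernel_on_triangle_continuous[OF K])
  have dC: "convolution_dominated ?C" by (rule convolution_dominated_difference[OF r'])
  have dK: "convolution_dominated ?K" by (rule convolution_dominated_continuous[OF K])
  have dpQ: "convolution_dominated (\<lambda>t s. p j t * ?Q j t s)" if j: "j \<in> {1..N}" for j
  proof -
    obtain c where "\<And>t. norm (p j t) \<le> c" using C0T_bounded[OF p[OF j]] by blast
    then show ?thesis
      by (rule convolution_dominated_scale[OF convolution_dominated_difference[OF q'[OF j]]
            C0T_borel[OF p[OF j]]])
  qed
  have dA: "convolution_dominated ?A"
    by (intro convolution_dominated_sum dpQ) auto
  have dB: "convolution_dominated ?B"
  proof -
    obtain M where "\<And>t s. norm (?K t s) \<le> M" using on_triangle_bounded[OF K] by blast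
    then show ?thesis
      by (rule convolution_dominated_kernel_comp[OF bK _ _ r']) (auto simp: on_triangle_def)
  qed
  have dH: "convolution_dominated H"
    using convolution_dominated_add[OF dA dB] by (simp add: H_def[abs_def])
  have GL: "on_triangle T (G_L r N q p K) t s
      = (\<Sum>j=1..N. p j t * on_triangle T (\<lambda>t s. q j (t - s)) t s) + ?B t s" for t s
  proof -
    have "?K t \<xi> * on_triangle T (\<lambda>t s. r (t - s)) \<xi> s
        = (if 0 \<le> s \<and> s \<le> t \<and> t \<le> T then indicator {s..t} \<xi> *\<^sub>R (K t \<xi> * r (\<xi> - s)) else 0)" for \<xi>
      by (auto simp: on_triangle_def indicator_def)
    then have "(\<integral>\<xi>. ?K t \<xi> * on_triangle T (\<lambda>t s. r (t - s)) \<xi> s \<partial>lebesgue)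
        = (if 0 \<le> s \<and> s \<le> t \<and> t \<le> T then (LINT \<xi>:{s..t}|lebesgue. K t \<xi> * r (\<xi> - s)) else 0)"
      by (auto simp: set_lebesgue_integral_def)
    moreover have "(\<integral>\<xi>. ?K t \<xi> * on_triangle T (\<lambda>t s. r (t - s)) \<xi> s \<partial>lebesgue) = ?B t s"
    proof (rule lebesgue_composition_eq_kernel_comp[OF bK _ _ rae])
      show "ae_kernel_eq ?K ?K" by (simp add: ae_kernel_eq_def)
      show "borel_kernel ?C" using dC by (simp add: convolution_dominated_def)
    qed
    ultimately show ?thesis
      by (auto simp: on_triangle_def G_L_def split: if_splits)
  qed
  have ae: "ae_kernel_eq (on_triangle T (G_L r N q p K)) H"
    unfolding ae_kernel_eq_def
  proof safe
    fix t
    have "AE s in lborel. \<forall>j\<in>{1..N}. on_triangle T (\<lambda>t s. q j (t - s)) t s = ?Q j t s"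
      using qae by (intro AE_finite_allI) (auto simp: ae_kernel_eq_def)
    then show "AE s in lborel. on_triangle T (G_L r N q p K) t s = H t s"
      by eventually_elim (simp add: GL H_def)
  next
    fix s
    have "AE t in lborel. \<forall>j\<in>{1..N}. on_triangle T (\<lambda>t s. q j (t - s)) t s = ?Q j t s"
      using qae by (intro AE_finite_allI) (auto simp: ae_kernel_eq_def)
    then show "AE t in lborel. on_triangle T (G_L r N q p K) t s = H t s"
      by eventually_elim (simp add: GL H_def)
  qed
  have apply_H: "kernel_op H v t = (\<Sum>j=1..N. p j t * kernel_op (?Q j) v t) + kernel_op ?K (kernel_op ?C v) t"
    if v: "v \<in> C0T T" for v t
  proof -
    have "kernel_op H v t = (\<integral>s. ?A t s * v s + ?B t s * v s \<partial>lborel)"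
      by (simp add: kernel_op_def H_def distrib_right)
    also have "\<dots> = (\<integral>s. ?A t s * v s \<partial>lborel) + kernel_op ?B v t"
      unfolding kernel_op_def
      by (intro Bochner_Integration.integral_add integrable_kernel_C0T[OF dA v] integrable_kernel_C0T[OF dB v])
    also have "(\<integral>s. ?A t s * v s \<partial>lborel) = (\<Sum>j=1..N. \<integral>s. p j t * ?Q j t s * v s \<partial>lborel)"
      unfolding sum_distrib_right
      by (intro Bochner_Integration.integral_sum integrable_kernel_C0T[OF dpQ v])
    also have "\<dots> = (\<Sum>j=1..N. p j t * kernel_op (?Q j) v t)"
      by (simp add: kernel_op_def mult.assoc)
    also have "kernel_op ?B v t = kernel_op ?K (kernel_op ?C v) t"
      by (rule kernel_op_kernel_comp_C0T[OF dK dC v])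
    finally show ?thesis .
  qed
  show ?thesis
  proof (rule that[OF dH ae])
    fix v assume v: "v \<in> C0T T"
    have "(\<lambda>t. (\<Sum>j=1..N. p j t * kernel_op (?Q j) v t) + kernel_op ?K (kernel_op ?C v) t) \<in> C0T T"
      by (intro C0T_add C0T_sum C0T_mult p QC v kernel_op_continuous_in_C0T[OF K] RC) auto
    then show "kernel_op H v \<in> C0T T"
      by (simp add: apply_H[OF v, abs_def])
    have "volterra T K (kernel_op ?C v) = kernel_op ?K (kernel_op ?C v)"
      by (rule volterra_eq_kernel_op[OF bK _ C0T_borel[OF RC[OF v]]]) (simp add: ae_kernel_eq_def)
    then show "kernel_op H v t = (\<Sum>j=1..N. p j t * conv_op T (q j) v t) + volterra T K (conv_op T r v) t" for t
      using apply_H[OF v, of t] Q v R by simp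
  qed
qed

theorem theorem3:
  fixes T :: real and r :: "real \<Rightarrow> complex" and N :: nat
    and B :: "nat \<Rightarrow> (real \<Rightarrow> complex) \<Rightarrow> real \<Rightarrow> complex"
    and q p :: "nat \<Rightarrow> real \<Rightarrow> complex"
    and K :: "real \<Rightarrow> real \<Rightarrow> complex"
    and S :: "(real \<Rightarrow> complex) set"
    and \<Lambda> :: "nat \<Rightarrow> (real \<Rightarrow> complex) \<Rightarrow> real \<Rightarrow> complex"
    and P :: "real \<Rightarrow> complex"
  assumes "T > 0"
    and "admissible_causal_inverse T r"
    and "\<And>j. j \<in> {1..N} \<Longrightarrow> clinear_on (conv_op T r ` C0T T) (B j)"
    and "\<And>j v. j \<in> {1..N} \<Longrightarrow> v \<in> C0T T \<Longrightarrow> B j (conv_op T r v) = conv_op T (q j) v"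
    and "\<And>j. j \<in> {1..N} \<Longrightarrow> weakly_singular T (q j)"
    and "\<And>j. j \<in> {1..N} \<Longrightarrow> p j \<in> C0T T"
    and "continuous_on {(t, s). 0 \<le> s \<and> s \<le> t \<and> t \<le> T} (\<lambda>(t, s). K t s)"
    and "S \<subseteq> C0T T" and "finite_dim_subspace S"
    and "S \<inter> conv_op T r ` C0T T = {0}"
    and "\<And>j. j \<in> {1..N} \<Longrightarrow> clinear_on S (\<Lambda> j)"
    and "\<And>j. j \<in> {1..N} \<Longrightarrow> \<Lambda> j ` S \<subseteq> C0T T"
    and "P \<in> S"
  shows "(\<forall>f\<in>C0T T.
           (\<exists>!u. u \<in> slice T r P \<and> L_bd T r S N \<Lambda> q p K u = f) \<and>
           (let g = f - F_bd T N \<Lambda> p K P;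
                u = P + conv_op T r (g - volterra T (resolvent_kernel (G_L r N q p K)) g)
            in u \<in> slice T r P \<and> L_bd T r S N \<Lambda> q p K u = f))
         \<and> (\<forall>v\<in>C0T T. L_bd T r S N \<Lambda> q p K (P + conv_op T r v)
              = F_bd T N \<Lambda> p K P + (v + volterra T (G_L r N q p K) v))"
proof -
  note adm = assms(2) and q = assms(5) and p = assms(6) and K = assms(7)
    and SC = assms(8) and dir = assms(10) and LC = assms(12) and P = assms(13)
  from adm have ws: "weakly_singular T r" and RC: "\<And>v. v \<in> C0T T \<Longrightarrow> conv_op T r v \<in> C0T T"
    and inj: "inj_on (conv_op T r) (C0T T)"
    by (auto simp: admissible_causal_inverse_def)
  have sub: "cfun.subspace S" using assms(9) by (simp add: finite_dim_subspace_def)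
  have PC: "P \<in> C0T T" using P SC by blast
  let ?F = "F_bd T N \<Lambda> p K P"
  let ?L = "L_bd T r S N \<Lambda> q p K"
  obtain H where dH: "convolution_dominated H"
    and ae: "ae_kernel_eq (on_triangle T (G_L r N q p K)) H"
    and HC: "\<And>v. v \<in> C0T T \<Longrightarrow> kernel_op H v \<in> C0T T"
    and H: "\<And>v t. v \<in> C0T T \<Longrightarrow>
      kernel_op H v t = (\<Sum>j=1..N. p j t * conv_op T (q j) v t) + volterra T K (conv_op T r v) t"
    using G_L_borel_representative[where N = N and q = q and p = p and K = K, OF ws q p K] by blast
  have bH: "borel_kernel H" using dH by (simp add: convolution_dominated_def)
  have W: "volterra T (G_L r N q p K) v = kernel_op H v" if "v \<in> C0T T" for v
    by (rule volterra_eq_kernel_op[OF bH ae C0T_borel[OF that]])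
  have VR: "volterra T (resolvent_kernel (G_L r N q p K)) g = kernel_op (neumann_kernel H) g"
    if "g \<in> C0T T" for g
    by (rule volterra_eq_kernel_op[OF borel_kernel_neumann_kernel[OF bH]
          resolvent_kernel_ae_eq_neumann_kernel[OF bH ae] C0T_borel[OF that]])
  have VK: "volterra T K v = kernel_op (on_triangle T K) v" if "v \<in> C0T T" for v
    by (rule volterra_eq_kernel_op[OF borel_kernel_on_triangle_continuous[OF K] _ C0T_borel[OF that]])
       (simp add: ae_kernel_eq_def)
  have FC: "?F \<in> C0T T"
    unfolding F_bd_def VK[OF PC]
    using LC P by (intro C0T_add C0T_sum C0T_mult p kernel_op_continuous_in_C0T[OF K] PC) auto

  have A: "A_bd T r S (P + conv_op T r v) = v" if v: "v \<in> C0T T" for v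
    unfolding A_bd_def
    using direct_sum_components[OF sub SC ws inj dir] P v by (intro the_equality) blast+
  have bd: "boundary_part T r S (P + conv_op T r v) = P" if v: "v \<in> C0T T" for v
    unfolding boundary_part_def
    using direct_sum_components[OF sub SC ws inj dir] P v by (intro the_equality) blast+

  have block: "?L (P + conv_op T r v) = ?F + (v + kernel_op H v)" if v: "v \<in> C0T T" for v
  proof
    fix t
    have "volterra T K (P + conv_op T r v) t = volterra T K P t + volterra T K (conv_op T r v) t"
      using kernel_op_add_C0T[OF convolution_dominated_continuous[OF K] PC RC[OF v], of t]
        C0T_add[OF PC RC[OF v]]
      by (simp add: VK PC RC v plus_fun_def)
    then show "?L (P + conv_op T r v) t = (?F + (v + kernel_op H v)) t"
      by (simp add: L_bd_def F_bd_def B_bd_def A bd v H distrib_left sum.distrib)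
  qed

  have solve: "(\<exists>!u. u \<in> slice T r P \<and> ?L u = f) \<and>
      (let g = f - ?F; u = P + conv_op T r (g - volterra T (resolvent_kernel (G_L r N q p K)) g)
       in u \<in> slice T r P \<and> ?L u = f)" if f: "f \<in> C0T T" for f
  proof -
    define g where "g = f - ?F"
    have g: "g \<in> C0T T" using C0T_diff[OF f FC] by (simp add: g_def fun_diff_def)
    define x where "x = g - volterra T (resolvent_kernel (G_L r N q p K)) g"
    have x_eq: "x = (\<lambda>t. g t - kernel_op (neumann_kernel H) g t)"
      by (simp add: x_def VR[OF g] fun_eq_iff)
    have maps: "kernel_op H ` C0T T \<subseteq> C0T T" using HC by blast
    note sk = second_kind_equation_C0T[OF dH maps g, folded x_eq]
    have x: "x \<in> C0T T" by (rule sk(1))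
    have "x + kernel_op H x = g"
    proof
      show "(x + kernel_op H x) t = g t" for t using sk(2)[of t] fun_cong[OF x_eq, of t] by simp
    qed
    then have sol: "?L (P + conv_op T r x) = f"
      by (simp only: block[OF x]) (simp add: g_def)
    have uniq: "u = P + conv_op T r x" if "u \<in> slice T r P" "?L u = f" for u
    proof -
      from that(1) obtain v where v: "v \<in> C0T T" and u: "u = P + conv_op T r v"
        by (auto simp: slice_def)
      have eq: "?F + (v + kernel_op H v) = f"
        using that(2) by (simp only: u block[OF v])
      have "v t + kernel_op H v t = g t" for t
        using fun_cong[OF eq, of t] by (simp add: g_def eq_diff_eq add_ac)
      then have "v = x" by (rule sk(3)[OF v])
      with u show ?thesis by simp
    qed
    have "P + conv_op T r x \<in> slice T r P" using x by (auto simp: slice_def)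
    with sol uniq show ?thesis
      unfolding Let_def g_def[symmetric] x_def[symmetric] by blast
  qed
  show ?thesis
    using solve block W by simp
qed

end
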